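(* Let $\widehat{\mathbf{n}}'=\{n_k'\}_{k=1}^{\infty}$ and $\widehat{\mathbf{n}}''=\{n_k''\}_{k=1}^{\infty}$ be sequences of positive integers with $n_k',n_k''>1$ for all $k$. Put $N_k'=\prod_{i=1}^{k}n_i'$ and $N_k''=\prod_{i=1}^{k}n_i''$. Then the groups $\mathfrak{S}_{\widehat{\mathbf{n}}'}$ and $\mathfrak{S}_{\widehat{\mathbf{n}}''}$ are isomorphic if and only if for each prime number $p$ $$\lim_{k\to\infty}\deg_p(N_k')=\lim_{k\to\infty}\deg_p(N_k'')\quad(\text{limits in }\mathbb{N}\cup\{0,\infty\}).$$ In other words, they are isomorphic iff for each prime $p$ either both sequences $\{\deg_p(N_k')\}_{k}$ and $\{\deg_p(N_k'')\}_{k}$ are unbounded, or there is a non-negative integer $d_p$ such that $\deg_p(N_k')=\deg_p(N_k'')=d_p$ for all sufficiently large $k$.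
   Context: For a prime $p$ and a positive integer $N$, $\deg_p(N)$ is the exponent of $p$ in the prime factorization of $N$. For a positive integer $N$, $\mathfrak{S}_N$ is the group of all bijections of $\mathbb{X}_N=\{0,1,\dots,N-1\}$. Given a sequence $\widehat{\mathbf{n}}=\{n_k\}$ of integers $n_k>1$, put $N_k=n_1n_2\cdots n_k$. For $j>k$ identify $\mathbb{X}_{N_j}$ with $\mathbb{X}_{N_k}\times\mathbb{X}_{N_j/N_k}$ via $x_1+N_kx_2\leftrightarrow(x_1,x_2)$, and let $\mathfrak{i}_{k,j}:\mathfrak{S}_{N_k}\to\mathfrak{S}_{N_j}$ be the embedding $\mathfrak{i}_{k,j}(\sigma)(x_1,x_2)=(\sigma(x_1),x_2)$. Then $\mathfrak{S}_{\widehat{\mathbf{n}}}=\varinjlim\mathfrak{S}_{N_k}=\bigcup_k\mathfrak{S}_{N_k}$ is the inductive limit along these embeddings. *)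

theory Defs
  imports
    "HOL-Algebra.Bij"
    "HOL-Computational_Algebra.Primes"
    "HOL-Library.Extended_Real"
begin

section \<open>Inductive limits of groups\<close>

text \<open>
  The system consists of groups \<open>G k\<close> for \<open>k \<in> I\<close> and connecting homomorphisms
  \<open>\<phi> k j\<close> from \<open>G k\<close> to \<open>G j\<close> for \<open>k \<le> j\<close>. Its inductive limit is the quotient of the
  disjoint union of the carriers by the relation of becoming equal at some later stage.
\<close>

definition ind_lim_rel ::
  "'i::linorder set \<Rightarrow> ('i \<Rightarrow> ('a, 'b) monoid_scheme) \<Rightarrow> ('i \<Rightarrow> 'i \<Rightarrow> 'a \<Rightarrow> 'a) \<Rightarrow> ('i \<times> 'a) rel"
  where
  "ind_lim_rel I G \<phi> =
     {((k, x), (j, y)). k \<in> I \<and> j \<in> I \<and> x \<in> carrier (G k) \<and> y \<in> carrier (G j) \<and>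
        (\<exists>l\<in>I. k \<le> l \<and> j \<le> l \<and> \<phi> k l x = \<phi> j l y)}"

definition ind_lim_class ::
  "'i::linorder set \<Rightarrow> ('i \<Rightarrow> ('a, 'b) monoid_scheme) \<Rightarrow> ('i \<Rightarrow> 'i \<Rightarrow> 'a \<Rightarrow> 'a) \<Rightarrow>
   'i \<Rightarrow> 'a \<Rightarrow> ('i \<times> 'a) set"
  where "ind_lim_class I G \<phi> k x = ind_lim_rel I G \<phi> `` {(k, x)}"

text \<open>
  The unions below range over all choices of representatives; for a direct system all
  these choices yield the same class, cf. \<open>mult_class\<close> and \<open>one_class\<close>.
\<close>

definition ind_lim ::
  "'i::linorder set \<Rightarrow> ('i \<Rightarrow> ('a, 'b) monoid_scheme) \<Rightarrow> ('i \<Rightarrow> 'i \<Rightarrow> 'a \<Rightarrow> 'a) \<Rightarrow>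
   ('i \<times> 'a) set monoid"
  where
  "ind_lim I G \<phi> =
     \<lparr>carrier = (SIGMA k:I. carrier (G k)) // ind_lim_rel I G \<phi>,
      monoid.mult = (\<lambda>A B. \<Union>(k, x)\<in>A. \<Union>(j, y)\<in>B.
        ind_lim_class I G \<phi> (max k j)
          (\<phi> k (max k j) x \<otimes>\<^bsub>G (max k j)\<^esub> \<phi> j (max k j) y)),
      one = (\<Union>k\<in>I. ind_lim_class I G \<phi> k \<one>\<^bsub>G k\<^esub>)\<rparr>"

locale direct_system =
  fixes I :: "'i::linorder set"
    and G :: "'i \<Rightarrow> ('a, 'b) monoid_scheme"
    and \<phi> :: "'i \<Rightarrow> 'i \<Rightarrow> 'a \<Rightarrow> 'a"
  assumes nonempty: "I \<noteq> {}"
    and group: "k \<in> I \<Longrightarrow> group (G k)"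
    and hom: "\<lbrakk>k \<in> I; j \<in> I; k \<le> j\<rbrakk> \<Longrightarrow> \<phi> k j \<in> hom (G k) (G j)"
    and refl_map: "\<lbrakk>k \<in> I; x \<in> carrier (G k)\<rbrakk> \<Longrightarrow> \<phi> k k x = x"
    and comp_map: "\<lbrakk>k \<in> I; j \<in> I; l \<in> I; k \<le> j; j \<le> l; x \<in> carrier (G k)\<rbrakk> \<Longrightarrow>
      \<phi> j l (\<phi> k j x) = \<phi> k l x"
begin

abbreviation "cls \<equiv> ind_lim_class I G \<phi>"
abbreviation "rel \<equiv> ind_lim_rel I G \<phi>"
abbreviation "L \<equiv> ind_lim I G \<phi>"

lemma closed: "\<lbrakk>k \<in> I; j \<in> I; k \<le> j; x \<in> carrier (G k)\<rbrakk> \<Longrightarrow> \<phi> k j x \<in> carrier (G j)"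
  using hom[of k j] by (auto simp: hom_def)

lemma map_mult: "\<lbrakk>k \<in> I; j \<in> I; k \<le> j; x \<in> carrier (G k); y \<in> carrier (G k)\<rbrakk> \<Longrightarrow>
    \<phi> k j (x \<otimes>\<^bsub>G k\<^esub> y) = \<phi> k j x \<otimes>\<^bsub>G j\<^esub> \<phi> k j y"
  using hom[of k j] by (auto simp: hom_def)

lemma map_one: "\<lbrakk>k \<in> I; j \<in> I; k \<le> j\<rbrakk> \<Longrightarrow> \<phi> k j \<one>\<^bsub>G k\<^esub> = \<one>\<^bsub>G j\<^esub>"
  using hom_one[OF hom[of k j] group group] by blast

lemma rel_later:
  assumes "k \<in> I" "j \<in> I" "l \<in> I" "m \<in> I" "k \<le> l" "j \<le> l" "l \<le> m"
    "x \<in> carrier (G k)" "y \<in> carrier (G j)" "\<phi> k l x = \<phi> j l y"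
  shows "\<phi> k m x = \<phi> j m y"
  using assms comp_map[of k l m x] comp_map[of j l m y] by simp

lemma equiv_rel: "equiv (SIGMA k:I. carrier (G k)) rel"
proof (rule equivI)
  show "rel \<subseteq> (SIGMA k:I. carrier (G k)) \<times> (SIGMA k:I. carrier (G k))"
    by (auto simp: ind_lim_rel_def)
  show "refl_on (SIGMA k:I. carrier (G k)) rel"
    by (auto simp: refl_on_def ind_lim_rel_def)
  show "sym rel"
    by (force simp: sym_def ind_lim_rel_def)
  show "trans rel"
  proof (rule transI)
    fix a b c assume ab: "(a, b) \<in> rel" and bc: "(b, c) \<in> rel"
    obtain k x j y i z where [simp]: "a = (k, x)" "b = (j, y)" "c = (i, z)"
      by (metis surj_pair)
    from ab obtain l where l: "k \<in> I" "j \<in> I" "x \<in> carrier (G k)" "y \<in> carrier (G j)"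
      "l \<in> I" "k \<le> l" "j \<le> l" "\<phi> k l x = \<phi> j l y" by (auto simp: ind_lim_rel_def)
    from bc obtain m where m: "i \<in> I" "z \<in> carrier (G i)"
      "m \<in> I" "j \<le> m" "i \<le> m" "\<phi> j m y = \<phi> i m z" by (auto simp: ind_lim_rel_def)
    define n where "n = max l m"
    have n: "n \<in> I" "l \<le> n" "m \<le> n" using l m by (auto simp: n_def max_def)
    have "\<phi> k n x = \<phi> j n y" using rel_later[of k j l n x y] l n by blast
    moreover have "\<phi> j n y = \<phi> i n z" using rel_later[of j i m n y z] l m n by blast
    ultimately show "(a, c) \<in> rel"
      using l m n by (auto simp: ind_lim_rel_def intro!: bexI[of _ n])
  qed
qed

lemma class_eq_iff:
  assumes "k \<in> I" "j \<in> I" "x \<in> carrier (G k)" "y \<in> carrier (G j)"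
  shows "cls k x = cls j y \<longleftrightarrow> (\<exists>l\<in>I. k \<le> l \<and> j \<le> l \<and> \<phi> k l x = \<phi> j l y)"
  using eq_equiv_class_iff[OF equiv_rel, of "(k, x)" "(j, y)"] assms
  by (auto simp: ind_lim_class_def ind_lim_rel_def)

lemma class_map:
  assumes "k \<in> I" "j \<in> I" "k \<le> j" "x \<in> carrier (G k)"
  shows "cls j (\<phi> k j x) = cls k x"
  using assms closed[of k j x] refl_map[of j "\<phi> k j x"]
  by (subst class_eq_iff) (auto intro!: bexI[of _ j])

lemma carrier_ind_lim: "carrier L = {cls k x |k x. k \<in> I \<and> x \<in> carrier (G k)}"
  by (auto simp: ind_lim_def quotient_def ind_lim_class_def)

lemma mult_class:
  assumes "k \<in> I" "j \<in> I" "x \<in> carrier (G k)" "y \<in> carrier (G j)"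
  shows "cls k x \<otimes>\<^bsub>L\<^esub> cls j y =
    cls (max k j) (\<phi> k (max k j) x \<otimes>\<^bsub>G (max k j)\<^esub> \<phi> j (max k j) y)"
proof -
  let ?p = "\<lambda>k x j y. cls (max k j) (\<phi> k (max k j) x \<otimes>\<^bsub>G (max k j)\<^esub> \<phi> j (max k j) y)"
  have late: "?p k x j y = cls m (\<phi> k m x \<otimes>\<^bsub>G m\<^esub> \<phi> j m y)"
    if "k \<in> I" "j \<in> I" "m \<in> I" "k \<le> m" "j \<le> m" "x \<in> carrier (G k)" "y \<in> carrier (G j)"
    for k j m x y
  proof -
    have M: "max k j \<in> I" "max k j \<le> m" using that by (auto simp: max_def)
    have cl: "\<phi> k (max k j) x \<in> carrier (G (max k j))" "\<phi> j (max k j) y \<in> carrier (G (max k j))"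
      using that M closed by auto
    interpret M: group "G (max k j)" using group M by blast
    have "?p k x j y = cls m (\<phi> (max k j) m (\<phi> k (max k j) x \<otimes>\<^bsub>G (max k j)\<^esub> \<phi> j (max k j) y))"
      using that M cl by (subst class_map) auto
    also have "\<phi> (max k j) m (\<phi> k (max k j) x \<otimes>\<^bsub>G (max k j)\<^esub> \<phi> j (max k j) y) =
        \<phi> k m x \<otimes>\<^bsub>G m\<^esub> \<phi> j m y"
      using that M cl by (subst map_mult) (auto simp: comp_map)
    finally show ?thesis .
  qed
  have same: "?p k' x' j' y' = ?p k x j y" if "(k', x') \<in> cls k x" "(j', y') \<in> cls j y"
    for k' x' j' y'
  proof -
    obtain l where l: "k' \<in> I" "x' \<in> carrier (G k')" "l \<in> I" "k \<le> l" "k' \<le> l"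
      "\<phi> k l x = \<phi> k' l x'" using \<open>(k', x') \<in> cls k x\<close>
      by (auto simp: ind_lim_class_def ind_lim_rel_def)
    obtain m where m: "j' \<in> I" "y' \<in> carrier (G j')" "m \<in> I" "j \<le> m" "j' \<le> m"
      "\<phi> j m y = \<phi> j' m y'" using \<open>(j', y') \<in> cls j y\<close>
      by (auto simp: ind_lim_class_def ind_lim_rel_def)
    define n where "n = max l m"
    have n: "n \<in> I" "l \<le> n" "m \<le> n" using l m by (auto simp: n_def max_def)
    have le: "k \<le> n" "k' \<le> n" "j \<le> n" "j' \<le> n" using l m n by auto
    have 1: "\<phi> k n x = \<phi> k' n x'" using rel_later[of k k' l n x x'] assms l n by blast
    have 2: "\<phi> j n y = \<phi> j' n y'" using rel_later[of j j' m n y y'] assms m n by blast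
    have "?p k' x' j' y' = cls n (\<phi> k' n x' \<otimes>\<^bsub>G n\<^esub> \<phi> j' n y')"
      by (rule late) (use le l m n in blast)+
    also have "\<dots> = cls n (\<phi> k n x \<otimes>\<^bsub>G n\<^esub> \<phi> j n y)"
      unfolding 1 2 ..
    also have "\<dots> = ?p k x j y"
      by (rule late[symmetric]) (use le assms n in blast)+
    finally show ?thesis .
  qed
  have ne: "cls k x \<noteq> {}" "cls j y \<noteq> {}"
    using equiv_class_self[OF equiv_rel] assms by (auto simp: ind_lim_class_def)
  have "cls k x \<otimes>\<^bsub>L\<^esub> cls j y = (\<Union>(k', x')\<in>cls k x. \<Union>(j', y')\<in>cls j y. ?p k' x' j' y')"
    by (simp add: ind_lim_def)
  also have "\<dots> = (\<Union>a\<in>cls k x. \<Union>b\<in>cls j y. ?p k x j y)"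
    by (rule SUP_cong[OF refl], clarify, rule SUP_cong[OF refl], clarify, rule same)
  also have "\<dots> = ?p k x j y" using ne by (simp only: UN_constant if_False)
  finally show ?thesis .
qed

lemma mult_class_same:
  assumes "k \<in> I" "x \<in> carrier (G k)" "y \<in> carrier (G k)"
  shows "cls k x \<otimes>\<^bsub>L\<^esub> cls k y = cls k (x \<otimes>\<^bsub>G k\<^esub> y)"
  using mult_class[OF assms(1,1,2,3)] assms by (simp add: refl_map)

lemma one_class:
  assumes "k \<in> I" shows "\<one>\<^bsub>L\<^esub> = cls k \<one>\<^bsub>G k\<^esub>"
proof -
  have same: "cls j \<one>\<^bsub>G j\<^esub> = cls k \<one>\<^bsub>G k\<^esub>" if "j \<in> I" for j
  proof -
    have "max j k \<in> I" using that assms by (auto simp: max_def)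
    then show ?thesis
      using assms that group[THEN group.is_monoid, THEN monoid.one_closed]
      by (subst class_eq_iff) (auto simp: map_one intro!: bexI[of _ "max j k"])
  qed
  have "\<one>\<^bsub>L\<^esub> = (\<Union>j\<in>I. cls j \<one>\<^bsub>G j\<^esub>)" by (simp add: ind_lim_def)
  also have "\<dots> = (\<Union>j\<in>I. cls k \<one>\<^bsub>G k\<^esub>)" by (rule SUP_cong[OF refl], rule same)
  finally show ?thesis using nonempty by (simp only: UN_constant if_False)
qed

lemma class_hom: "k \<in> I \<Longrightarrow> cls k \<in> hom (G k) L"
  by (auto simp: hom_def carrier_ind_lim mult_class_same)

lemma common_stage:
  assumes "A \<in> carrier L" "B \<in> carrier L"
  obtains k x y where "k \<in> I" "x \<in> carrier (G k)" "y \<in> carrier (G k)" "A = cls k x" "B = cls k y"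
proof -
  obtain k x j y where *: "k \<in> I" "j \<in> I" "x \<in> carrier (G k)" "y \<in> carrier (G j)"
    "A = cls k x" "B = cls j y" using assms by (auto simp: carrier_ind_lim)
  have "max k j \<in> I" using * by (auto simp: max_def)
  then show ?thesis
    using that[of "max k j" "\<phi> k (max k j) x" "\<phi> j (max k j) y"] * closed class_map by simp
qed

lemma common_stage3:
  assumes "A \<in> carrier L" "B \<in> carrier L" "C \<in> carrier L"
  obtains k x y z where "k \<in> I" "x \<in> carrier (G k)" "y \<in> carrier (G k)" "z \<in> carrier (G k)"
    "A = cls k x" "B = cls k y" "C = cls k z"
proof -
  obtain k x y where *: "k \<in> I" "x \<in> carrier (G k)" "y \<in> carrier (G k)" "A = cls k x" "B = cls k y"
    using common_stage assms by blast
  obtain j z where j: "j \<in> I" "z \<in> carrier (G j)" "C = cls j z"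
    using assms by (auto simp: carrier_ind_lim)
  have "max k j \<in> I" using * j by (auto simp: max_def)
  then show ?thesis
    using that[of "max k j" "\<phi> k (max k j) x" "\<phi> k (max k j) y" "\<phi> j (max k j) z"]
      * j closed class_map by simp
qed

theorem group_ind_lim: "group L"
proof (rule groupI)
  fix A B assume "A \<in> carrier L" "B \<in> carrier L"
  then obtain k x y where *: "k \<in> I" "x \<in> carrier (G k)" "y \<in> carrier (G k)"
    "A = cls k x" "B = cls k y" by (rule common_stage)
  interpret group "G k" using group * by blast
  show "A \<otimes>\<^bsub>L\<^esub> B \<in> carrier L" using * by (auto simp: mult_class_same carrier_ind_lim)
next
  obtain k where k: "k \<in> I" using nonempty by blast
  interpret group "G k" using group k by blast
  show "\<one>\<^bsub>L\<^esub> \<in> carrier L" using k by (auto simp: one_class carrier_ind_lim)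
next
  fix A B C assume "A \<in> carrier L" "B \<in> carrier L" "C \<in> carrier L"
  then obtain k x y z where *: "k \<in> I" "x \<in> carrier (G k)" "y \<in> carrier (G k)" "z \<in> carrier (G k)"
    "A = cls k x" "B = cls k y" "C = cls k z" by (rule common_stage3)
  interpret group "G k" using group * by blast
  show "A \<otimes>\<^bsub>L\<^esub> B \<otimes>\<^bsub>L\<^esub> C = A \<otimes>\<^bsub>L\<^esub> (B \<otimes>\<^bsub>L\<^esub> C)" using * by (simp add: mult_class_same m_assoc)
next
  fix A assume "A \<in> carrier L"
  then obtain k x where *: "k \<in> I" "x \<in> carrier (G k)" "A = cls k x"
    by (auto simp: carrier_ind_lim)
  interpret group "G k" using group * by blast
  show "\<one>\<^bsub>L\<^esub> \<otimes>\<^bsub>L\<^esub> A = A" using * by (simp add: one_class[of k] mult_class_same)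
  show "\<exists>B\<in>carrier L. B \<otimes>\<^bsub>L\<^esub> A = \<one>\<^bsub>L\<^esub>"
  proof (rule bexI)
    show "cls k (inv\<^bsub>G k\<^esub> x) \<otimes>\<^bsub>L\<^esub> A = \<one>\<^bsub>L\<^esub>"
      using * by (simp add: one_class[of k] mult_class_same)
    show "cls k (inv\<^bsub>G k\<^esub> x) \<in> carrier L"
      using * by (auto simp: carrier_ind_lim)
  qed
qed

lemma class_inj:
  assumes "k \<in> I" "\<And>j. j \<in> I \<Longrightarrow> k \<le> j \<Longrightarrow> inj_on (\<phi> k j) (carrier (G k))"
  shows "inj_on (cls k) (carrier (G k))"
  by (rule inj_onI) (use assms in \<open>auto simp: class_eq_iff dest: inj_onD\<close>)

end


section \<open>The group attached to a sequence of integers\<close>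

text \<open>Sequences are indexed from 1; the value \<open>n 0\<close> is never used.\<close>

definition NN :: "(nat \<Rightarrow> nat) \<Rightarrow> nat \<Rightarrow> nat"
  where "NN n k = (\<Prod>i=1..k. n i)"

definition XX :: "nat \<Rightarrow> nat set"
  where "XX N = {0..<N}"

text \<open>
  The point \<open>x1 + N k * x2\<close> of \<open>XX (N j)\<close> corresponds to the pair \<open>(x1, x2)\<close>, so that
  \<open>x1 = x mod N k\<close> and \<open>x2 = x div N k\<close>. Restriction makes the result extensional, as
  required for the elements of \<^const>\<open>BijGroup\<close>.
\<close>

definition perm_embed :: "(nat \<Rightarrow> nat) \<Rightarrow> nat \<Rightarrow> nat \<Rightarrow> (nat \<Rightarrow> nat) \<Rightarrow> (nat \<Rightarrow> nat)"
  where "perm_embed n k j \<sigma> =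
    (\<lambda>x\<in>XX (NN n j). \<sigma> (x mod NN n k) + NN n k * (x div NN n k))"

definition lim_sym_group :: "(nat \<Rightarrow> nat) \<Rightarrow> (nat \<times> (nat \<Rightarrow> nat)) set monoid"
  where "lim_sym_group n = ind_lim {1..} (\<lambda>k. BijGroup (XX (NN n k))) (perm_embed n)"

lemma NN_dvd: "k \<le> j \<Longrightarrow> NN n k dvd NN n j"
  unfolding NN_def by (rule prod_dvd_prod_subset) auto

lemma NN_pos: "(\<And>i. i \<ge> 1 \<Longrightarrow> n i > 1) \<Longrightarrow> NN n k > 0"
  unfolding NN_def by (rule prod_pos) (metis atLeastAtMost_iff less_trans zero_less_one)

lemma perm_embed_eq:
  assumes "x1 \<in> XX (NN n k)" "x1 + NN n k * x2 \<in> XX (NN n j)"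
  shows "perm_embed n k j \<sigma> (x1 + NN n k * x2) = \<sigma> x1 + NN n k * x2"
  using assms by (simp add: perm_embed_def XX_def)

lemma XX_decomp:
  assumes "N > 0" "N dvd M" "x \<in> XX M"
  obtains x1 x2 where "x = x1 + N * x2" "x1 \<in> XX N" "x2 \<in> XX (M div N)"
proof (rule that)
  show "x = x mod N + N * (x div N)" by simp
  show "x mod N \<in> XX N" using assms by (simp add: XX_def)
  have "x < M div N * N" using assms by (simp add: XX_def)
  then show "x div N \<in> XX (M div N)" by (simp add: XX_def less_mult_imp_div_less)
qed

lemma XX_comp:
  assumes "N dvd M" "x1 \<in> XX N" "x2 \<in> XX (M div N)"
  shows "x1 + N * x2 \<in> XX M"
proof -
  have "x1 + N * x2 < N * Suc x2" using assms by (simp add: XX_def)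
  also have "\<dots> \<le> N * (M div N)" using assms by (intro mult_le_mono2) (simp add: XX_def)
  finally show ?thesis using assms by (simp add: XX_def)
qed

lemma Bij_XX_in: "\<lbrakk>\<sigma> \<in> Bij S; x \<in> S\<rbrakk> \<Longrightarrow> \<sigma> x \<in> S"
  by (auto simp: Bij_def bij_betw_def)

context
  fixes n :: "nat \<Rightarrow> nat"
  assumes n: "\<And>i. i \<ge> 1 \<Longrightarrow> n i > 1"
begin

lemma pos: "NN n k > 0"
  using n by (rule NN_pos)

lemma perm_embed_in:
  assumes "k \<le> j" "\<sigma> \<in> Bij (XX (NN n k))" "x \<in> XX (NN n j)"
  shows "perm_embed n k j \<sigma> x \<in> XX (NN n j)"
proof -
  obtain x1 x2 where x: "x = x1 + NN n k * x2" "x1 \<in> XX (NN n k)" "x2 \<in> XX (NN n j div NN n k)"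
    using XX_decomp[OF pos NN_dvd[OF assms(1)] assms(3)] by blast
  show ?thesis
    using XX_comp[OF NN_dvd[OF assms(1)] Bij_XX_in[OF assms(2) x(2)] x(3)] x assms(3)
    by (simp add: perm_embed_eq)
qed

lemma perm_embed_inj:
  assumes "k \<le> j" "\<sigma> \<in> Bij (XX (NN n k))"
  shows "inj_on (perm_embed n k j \<sigma>) (XX (NN n j))"
proof (rule inj_onI)
  fix x y assume xy: "x \<in> XX (NN n j)" "y \<in> XX (NN n j)"
    "perm_embed n k j \<sigma> x = perm_embed n k j \<sigma> y"
  obtain x1 x2 where x: "x = x1 + NN n k * x2" "x1 \<in> XX (NN n k)"
    using XX_decomp[OF pos NN_dvd[OF assms(1)] xy(1)] by blast
  obtain y1 y2 where y: "y = y1 + NN n k * y2" "y1 \<in> XX (NN n k)"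
    using XX_decomp[OF pos NN_dvd[OF assms(1)] xy(2)] by blast
  have eq: "\<sigma> x1 + NN n k * x2 = \<sigma> y1 + NN n k * y2"
    using x y xy by (simp add: perm_embed_eq)
  have lt: "\<sigma> x1 < NN n k" "\<sigma> y1 < NN n k"
    using Bij_XX_in[OF assms(2)] x y by (auto simp: XX_def)
  have "\<sigma> x1 = \<sigma> y1" using arg_cong[OF eq, of "\<lambda>z. z mod NN n k"] lt by simp
  moreover from this have "x2 = y2" using eq pos[of k] by simp
  ultimately show "x = y"
    using assms(2) x y by (auto simp: Bij_def bij_betw_def dest: inj_onD)
qed

lemma perm_embed_Bij:
  assumes "k \<le> j" "\<sigma> \<in> Bij (XX (NN n k))"
  shows "perm_embed n k j \<sigma> \<in> Bij (XX (NN n j))"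
proof -
  have "perm_embed n k j \<sigma> ` XX (NN n j) = XX (NN n j)"
    using perm_embed_in[OF assms] perm_embed_inj[OF assms]
    by (intro endo_inj_surj) (auto simp: XX_def)
  then show ?thesis
    using perm_embed_inj[OF assms] by (auto simp: Bij_def bij_betw_def perm_embed_def)
qed

lemma perm_embed_hom:
  assumes "k \<le> j"
  shows "perm_embed n k j \<in> hom (BijGroup (XX (NN n k))) (BijGroup (XX (NN n j)))"
proof (rule homI)
  fix \<sigma> assume "\<sigma> \<in> carrier (BijGroup (XX (NN n k)))"
  then show "perm_embed n k j \<sigma> \<in> carrier (BijGroup (XX (NN n j)))"
    using perm_embed_Bij[OF assms] by (simp add: BijGroup_def)
next
  fix \<sigma> \<tau> assume "\<sigma> \<in> carrier (BijGroup (XX (NN n k)))" "\<tau> \<in> carrier (BijGroup (XX (NN n k)))"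
  then have B: "\<sigma> \<in> Bij (XX (NN n k))" "\<tau> \<in> Bij (XX (NN n k))" by (auto simp: BijGroup_def)
  have "perm_embed n k j (compose (XX (NN n k)) \<sigma> \<tau>) =
      compose (XX (NN n j)) (perm_embed n k j \<sigma>) (perm_embed n k j \<tau>)"
  proof
    fix x
    show "perm_embed n k j (compose (XX (NN n k)) \<sigma> \<tau>) x =
      compose (XX (NN n j)) (perm_embed n k j \<sigma>) (perm_embed n k j \<tau>) x"
    proof (cases "x \<in> XX (NN n j)")
      case True
      obtain x1 x2 where x: "x = x1 + NN n k * x2" "x1 \<in> XX (NN n k)"
        using XX_decomp[OF pos NN_dvd[OF assms] True] by blast
      have "\<tau> x1 + NN n k * x2 \<in> XX (NN n j)"
        using perm_embed_in[OF assms B(2) True] x True by (simp add: perm_embed_eq)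
      then show ?thesis
        using x True Bij_XX_in[OF B(2) x(2)] by (simp add: perm_embed_eq compose_eq)
    qed (simp add: perm_embed_def compose_def)
  qed
  then show "perm_embed n k j (\<sigma> \<otimes>\<^bsub>BijGroup (XX (NN n k))\<^esub> \<tau>) =
      perm_embed n k j \<sigma> \<otimes>\<^bsub>BijGroup (XX (NN n j))\<^esub> perm_embed n k j \<tau>"
    using B perm_embed_Bij[OF assms] by (simp add: BijGroup_def)
qed

lemma direct_system_perm: "direct_system {1..} (\<lambda>k. BijGroup (XX (NN n k))) (perm_embed n)"
proof (rule direct_system.intro)
  show "{1::nat..} \<noteq> {}" by auto
  show "group (BijGroup (XX (NN n k)))" for k by (rule group_BijGroup)
  show "perm_embed n k j \<in> hom (BijGroup (XX (NN n k))) (BijGroup (XX (NN n j)))"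
    if "k \<le> j" for k j by (rule perm_embed_hom[OF that])
  show "perm_embed n k k \<sigma> = \<sigma>" if "\<sigma> \<in> carrier (BijGroup (XX (NN n k)))" for k \<sigma>
    using that by (auto simp: BijGroup_def Bij_def perm_embed_def XX_def extensional_def)
  show "perm_embed n j l (perm_embed n k j \<sigma>) = perm_embed n k l \<sigma>"
    if kj: "k \<le> j" and jl: "j \<le> l" and \<sigma>: "\<sigma> \<in> carrier (BijGroup (XX (NN n k)))" for k j l \<sigma>
  proof
    fix x
    have B: "\<sigma> \<in> Bij (XX (NN n k))" using \<sigma> by (simp add: BijGroup_def)
    show "perm_embed n j l (perm_embed n k j \<sigma>) x = perm_embed n k l \<sigma> x"
    proof (cases "x \<in> XX (NN n l)")
      case True
      obtain x1 x2 where x: "x = x1 + NN n j * x2" "x1 \<in> XX (NN n j)"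
        using XX_decomp[OF pos NN_dvd[OF jl] True] by blast
      obtain z1 z2 where z: "x1 = z1 + NN n k * z2" "z1 \<in> XX (NN n k)"
        using XX_decomp[OF pos NN_dvd[OF kj] x(2)] by blast
      obtain c where c: "NN n j = NN n k * c" using NN_dvd[OF kj] by (rule dvdE)
      have xz: "x = z1 + NN n k * (z2 + c * x2)" using x z c by (simp add: algebra_simps)
      have "perm_embed n j l (perm_embed n k j \<sigma>) x = perm_embed n k j \<sigma> x1 + NN n j * x2"
        using x True by (simp add: perm_embed_eq)
      also have "perm_embed n k j \<sigma> x1 = \<sigma> z1 + NN n k * z2"
        using x z by (simp add: perm_embed_eq)
      also have "\<sigma> z1 + NN n k * z2 + NN n j * x2 = \<sigma> z1 + NN n k * (z2 + c * x2)"
        using c by (simp add: algebra_simps)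
      also have "\<dots> = perm_embed n k l \<sigma> x"
        unfolding xz using z True xz by (subst perm_embed_eq) auto
      finally show ?thesis .
    qed (simp add: perm_embed_def)
  qed
qed

lemma group_lim_sym_group: "group (lim_sym_group n)"
  unfolding lim_sym_group_def by (rule direct_system.group_ind_lim[OF direct_system_perm])

end

end

theory Submission
  imports Defs "HOL-Combinatorics.Transposition"
begin

text \<open>
  Extending a permutation of \<open>{0..<N}\<close> periodically to all of \<open>\<nat>\<close>,
  block by block, is compatible with the connecting maps. So the inductive limit is a concrete
  group \<open>G\<close> of permutations of \<open>\<nat>\<close>, the increasing union over
  \<open>k\<close> of the groups of permutations that preserve each interval
  \<open>{iN..<(i+1)N}\<close>, \<open>N = N\<^sub>k\<close>, and commute with the shift by
  \<open>N\<close> (\<open>perm_limit_iso\<close>). The group for \<open>N\<close> is contained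
  in the one for \<open>M\<close> whenever \<open>N\<close> divides \<open>M\<close>. Hence two
  sequences for which the same integers divide some \<open>N\<^sub>k\<close> have even equal
  unions, which is the easy half of the classification.

  For the other half, the set of integers \<open>q\<close> dividing some \<open>N\<^sub>k\<close>
  has to be read off from the abstract group. If \<open>q\<close> divides
  \<open>N\<^sub>k\<close>, then \<open>G\<close> contains a permutation all of whose cycles have
  length \<open>q\<close>, namely a rotation of each interval of length \<open>q\<close>.
  Conversely such a permutation partitions \<open>{0..<N\<^sub>k}\<close>, for some
  \<open>k\<close>, into cycles of \<open>q\<close> elements, so \<open>q\<close> divides
  \<open>N\<^sub>k\<close>. It remains to recognize, among the elements \<open>t\<close> of order
  \<open>q\<close>, those with all cycles of length \<open>q\<close>. The centralizer
  \<open>C\<close> of \<open>t\<close> does this. If \<open>t\<close> has cycles of different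
  lengths, some power \<open>t\<^sup>i\<close> fixes some points and moves others, and
  \<open>C\<close> contains elements supported in \<open>Fix(t\<^sup>i)\<close> and elements
  supported in its complement. Since \<open>C\<close> preserves \<open>Fix(t\<^sup>i)\<close>,
  every \<open>C\<close>-conjugate of an element of the second kind commutes with every element
  of the first kind, and both kinds are noncommutative in the sense that some element does not
  commute with one of its own \<open>C\<close>-conjugates
  (\<open>split_centralizer_of_unequal_cycles\<close>). If all cycles have length
  \<open>q\<close>, then \<open>C\<close> is a union of wreath products of a cyclic group of
  order \<open>q\<close> with symmetric groups that permute the cycles. An element of
  \<open>C\<close> that maps each cycle to itself commutes with all its conjugates, as it lies in
  the commutative base group, and for two elements that do move cycles there is enough room to
  make a conjugate of one not commute with the other
  (\<open>not_split_centralizer_of_uniform_cycles\<close>). The resulting property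
  \<open>has_unsplit_element\<close> is invariant under isomorphism and says exactly that
  \<open>q\<close> divides some \<open>N\<^sub>k\<close>
  (\<open>has_unsplit_element_iff\<close>).

  What is left is arithmetic: having the same divisors of stages is a condition on the suprema of
  the exponents of the primes, and these exponents increase with \<open>k\<close>, so that their
  suprema are their limits.
\<close>

section \<open>Block permutations of the natural numbers\<close>

text \<open>
  The conditions say that \<open>f\<close> preserves each interval of length \<open>N\<close>
  between consecutive multiples of \<open>N\<close> and acts on all of them alike; so
  \<open>f\<close> is the periodic extension of a permutation of \<open>{0..<N}\<close>.
\<close>
definition block_perms :: "nat \<Rightarrow> (nat \<Rightarrow> nat) set"
  where "block_perms N = {f. bij f \<and> (\<forall>x. f x div N = x div N \<and> f (x + N) = f x + N)}"

definition periodic_ext :: "nat \<Rightarrow> (nat \<Rightarrow> nat) \<Rightarrow> nat \<Rightarrow> nat"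
  where "periodic_ext N \<sigma> x = \<sigma> (x mod N) + N * (x div N)"

lemma periodic_ext_eq: "x < N \<Longrightarrow> periodic_ext N \<sigma> x = \<sigma> x"
  by (simp add: periodic_ext_def)

lemma block_perms_bij: "f \<in> block_perms N \<Longrightarrow> bij f"
  by (simp add: block_perms_def)

lemma block_perms_div: "f \<in> block_perms N \<Longrightarrow> f x div N = x div N"
  by (simp add: block_perms_def)

lemma block_perms_shift: "f \<in> block_perms N \<Longrightarrow> f (x + N * i) = f x + N * i"
proof (induction i)
  case (Suc i)
  have "f (x + N * Suc i) = f ((x + N * i) + N)" by (simp add: algebra_simps)
  then show ?case using Suc by (simp add: block_perms_def)
qed simp

lemma block_perms_ext:
  assumes "f \<in> block_perms N"
  shows "f x = periodic_ext N f x"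
  using block_perms_shift[OF assms, of "x mod N" "x div N"] by (simp add: periodic_ext_def)

lemma block_perms_less_iff:
  assumes "f \<in> block_perms N" "N > 0"
  shows "f x < N \<longleftrightarrow> x < N"
proof -
  have "f x < N \<longleftrightarrow> f x div N = 0" using assms(2) by (auto simp: div_eq_0_iff)
  also have "\<dots> \<longleftrightarrow> x < N" using assms by (auto simp: block_perms_div div_eq_0_iff)
  finally show ?thesis .
qed

lemma block_perms_mod:
  assumes "f \<in> block_perms N" "N > 0"
  shows "f x mod N = f (x mod N)"
proof -
  have "f x = f (x mod N) + N * (x div N)"
    using block_perms_ext[OF assms(1), of x] by (simp only: periodic_ext_def)
  moreover have "f (x mod N) < N" using block_perms_less_iff[OF assms] assms(2) by simp
  ultimately show ?thesis by simp
qed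

lemma periodic_ext_block_perms:
  assumes "N > 0" "bij_betw \<sigma> {..<N} {..<N}"
  shows "periodic_ext N \<sigma> \<in> block_perms N"
proof -
  have lt: "\<sigma> (x mod N) < N" for x
    using assms by (auto dest!: bij_betw_imp_surj_on)
  have dv: "periodic_ext N \<sigma> x div N = x div N" and md: "periodic_ext N \<sigma> x mod N = \<sigma> (x mod N)" for x
    using lt[of x] by (auto simp: periodic_ext_def)
  have "bij (periodic_ext N \<sigma>)"
  proof (rule bijI)
    show "inj (periodic_ext N \<sigma>)"
    proof (rule injI)
      fix x y assume eq: "periodic_ext N \<sigma> x = periodic_ext N \<sigma> y"
      have "x div N = y div N" using dv[of x] dv[of y] eq by simp
      moreover have "\<sigma> (x mod N) = \<sigma> (y mod N)" using md[of x] md[of y] eq by simp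
      then have "x mod N = y mod N"
        using assms by (auto simp: bij_betw_def dest!: inj_onD)
      ultimately show "x = y" by (metis div_mult_mod_eq)
    qed
    show "surj (periodic_ext N \<sigma>)"
    proof (rule surjI)
      fix z
      have "z mod N \<in> \<sigma> ` {..<N}" using assms by (simp add: bij_betw_def)
      then have "inv_into {..<N} \<sigma> (z mod N) < N" "\<sigma> (inv_into {..<N} \<sigma> (z mod N)) = z mod N"
        using inv_into_into[of "z mod N" \<sigma> "{..<N}"] f_inv_into_f[of "z mod N" \<sigma> "{..<N}"] by auto
      then show "periodic_ext N \<sigma> (inv_into {..<N} \<sigma> (z mod N) + N * (z div N)) = z"
        by (simp add: periodic_ext_def)
    qed
  qed
  moreover have "periodic_ext N \<sigma> (x + N) = periodic_ext N \<sigma> x + N" for x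
    using assms by (simp add: periodic_ext_def)
  ultimately show ?thesis using dv by (simp add: block_perms_def)
qed

lemma block_perms_bij_betw:
  assumes "f \<in> block_perms N" "N > 0"
  shows "bij_betw f {..<N} {..<N}"
proof -
  have "f ` {..<N} = {..<N}"
  proof (intro equalityI subsetI)
    fix y assume "y \<in> {..<N}"
    moreover obtain x where "y = f x"
      using bij_is_surj[OF block_perms_bij[OF assms(1)]] by blast
    ultimately show "y \<in> f ` {..<N}" using block_perms_less_iff[OF assms, of x] by simp
  qed (use block_perms_less_iff[OF assms] in auto)
  then show ?thesis
    using block_perms_bij[OF assms(1)] by (auto simp: bij_betw_def intro: inj_on_subset)
qed

text \<open>
  The blocks for \<open>M\<close> are unions of blocks for \<open>N\<close>, and the shift by
  \<open>M\<close> is a power of the shift by \<open>N\<close>. This inclusion takes the place of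
  the connecting maps.
\<close>
lemma block_perms_mono:
  assumes "N dvd M"
  shows "block_perms N \<subseteq> block_perms M"
proof
  fix f assume f: "f \<in> block_perms N"
  obtain c where M: "M = N * c" using assms by (rule dvdE)
  have "f x div M = x div M" for x
    using block_perms_div[OF f, of x] by (simp add: M div_mult2_eq)
  then show "f \<in> block_perms M"
    using f block_perms_shift[OF f] by (simp add: block_perms_def M)
qed

lemma id_block_perms: "id \<in> block_perms N"
  by (simp add: block_perms_def)

lemma comp_block_perms: "f \<in> block_perms N \<Longrightarrow> g \<in> block_perms N \<Longrightarrow> f \<circ> g \<in> block_perms N"
  by (auto simp: block_perms_def intro: bij_comp)

lemma inv_block_perms:
  assumes f: "f \<in> block_perms N"
  shows "inv_into UNIV f \<in> block_perms N"
proof -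
  have b: "bij f" using f by (rule block_perms_bij)
  have "inv_into UNIV f x div N = x div N" for x
    using block_perms_div[OF f, of "inv_into UNIV f x"] b by (simp add: bij_inv_eq_iff surj_f_inv_f bij_is_surj)
  moreover have "inv_into UNIV f (x + N) = inv_into UNIV f x + N" for x
  proof -
    have "f (inv_into UNIV f x + N) = x + N"
      using f b by (simp add: block_perms_def surj_f_inv_f bij_is_surj)
    then show ?thesis using b by (metis bij_inv_eq_iff)
  qed
  ultimately show ?thesis using b by (simp add: block_perms_def bij_imp_bij_inv)
qed

lemma funpow_block_perms: "f \<in> block_perms N \<Longrightarrow> f ^^ i \<in> block_perms N"
  by (induction i) (auto intro: comp_block_perms id_block_perms)


section \<open>The inductive limit as a group of permutations\<close>

definition perm_limit :: "(nat \<Rightarrow> nat) \<Rightarrow> (nat \<Rightarrow> nat) monoid"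
  where "perm_limit n =
    \<lparr>carrier = (\<Union>k\<in>{1..}. block_perms (NN n k)), monoid.mult = (\<circ>), one = id\<rparr>"

lemma perm_limit_simps [simp]:
  "monoid.mult (perm_limit n) = (\<circ>)" "monoid.one (perm_limit n) = id"
  by (simp_all add: perm_limit_def)

lemma carrier_perm_limit:
  "f \<in> carrier (perm_limit n) \<longleftrightarrow> (\<exists>k\<ge>1. f \<in> block_perms (NN n k))"
  by (auto simp: perm_limit_def)

lemma perm_limit_stage:
  "k \<ge> 1 \<Longrightarrow> f \<in> block_perms (NN n k) \<Longrightarrow> f \<in> carrier (perm_limit n)"
  by (auto simp: carrier_perm_limit)

lemma block_perms_NN_mono: "k \<le> j \<Longrightarrow> f \<in> block_perms (NN n k) \<Longrightarrow> f \<in> block_perms (NN n j)"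
  using block_perms_mono[OF NN_dvd] by blast

lemma common_block_stage:
  assumes "finite F" "F \<subseteq> carrier (perm_limit n)"
  obtains k where "k \<ge> 1" "F \<subseteq> block_perms (NN n k)"
proof -
  have "\<forall>f\<in>F. \<exists>k\<ge>1. f \<in> block_perms (NN n k)"
    using assms(2) by (auto simp: carrier_perm_limit)
  then obtain K where K: "\<And>f. f \<in> F \<Longrightarrow> f \<in> block_perms (NN n (K f))" by metis
  define k where "k = Max (insert 1 (K ` F))"
  have le: "i \<le> k" if "i \<in> insert 1 (K ` F)" for i
    unfolding k_def using that assms(1) by (intro Max_ge) auto
  then have "K f \<le> k" if "f \<in> F" for f using that by blast
  then have "F \<subseteq> block_perms (NN n k)" using K block_perms_NN_mono by blast
  moreover have "k \<ge> 1" using le by auto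
  ultimately show thesis using that by blast
qed

lemma bij_of_perm_limit: "f \<in> carrier (perm_limit n) \<Longrightarrow> bij f"
  by (auto simp: carrier_perm_limit dest: block_perms_bij)

lemma group_perm_limit: "group (perm_limit n)"
proof (rule groupI)
  fix f g assume "f \<in> carrier (perm_limit n)" "g \<in> carrier (perm_limit n)"
  then obtain k where "k \<ge> 1" "{f, g} \<subseteq> block_perms (NN n k)"
    using common_block_stage[of "{f, g}" n] by auto
  then show "f \<otimes>\<^bsub>perm_limit n\<^esub> g \<in> carrier (perm_limit n)"
    using comp_block_perms perm_limit_stage[of k "f \<circ> g" n] by simp
next
  fix f assume f: "f \<in> carrier (perm_limit n)"
  then have "inv_into UNIV f \<in> carrier (perm_limit n)" by (auto simp: carrier_perm_limit intro: inv_block_perms)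
  then show "\<exists>g\<in>carrier (perm_limit n). g \<otimes>\<^bsub>perm_limit n\<^esub> f = \<one>\<^bsub>perm_limit n\<^esub>"
    using bij_of_perm_limit[OF f] by (auto simp: bij_is_inj intro!: bexI[of _ "inv_into UNIV f"])
next
  show "\<one>\<^bsub>perm_limit n\<^esub> \<in> carrier (perm_limit n)"
    using perm_limit_stage[of 1 id n] id_block_perms by simp
qed (auto simp: comp_assoc)

lemma pow_perm_limit: "f [^]\<^bsub>perm_limit n\<^esub> (i::nat) = f ^^ i"
proof (induction i)
  case (Suc i)
  then show ?case by (simp add: nat_pow_def funpow_Suc_right del: funpow.simps)
qed (simp add: nat_pow_def)

lemma lt_NN:
  assumes n: "\<And>i. i \<ge> 1 \<Longrightarrow> n i > 1"
  shows "k < NN n k"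
proof (induction k)
  case 0
  then show ?case by (simp add: NN_def)
next
  case (Suc k)
  have "NN n (Suc k) = n (Suc k) * NN n k" by (simp add: NN_def)
  moreover have "2 * NN n k \<le> n (Suc k) * NN n k" using n[of "Suc k"] by (intro mult_le_mono1) simp
  ultimately show ?case using Suc by linarith
qed

context
  fixes n :: "nat \<Rightarrow> nat"
  assumes n: "\<And>i. i \<ge> 1 \<Longrightarrow> n i > 1"
begin

lemma NN_positive: "NN n k > 0"
  using n by (rule NN_pos)

(* The simplifier would otherwise rewrite the index set {1..} and separate the facts about the
   inductive limit from the goals. *)
declare One_nat_def [simp del]

interpretation D: direct_system "{1..}" "\<lambda>k. BijGroup (XX (NN n k))" "perm_embed n"
  using n by (rule direct_system_perm)

lemma restrict_block_perms:
  assumes "f \<in> block_perms (NN n k)"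
  shows "restrict f (XX (NN n k)) \<in> carrier (BijGroup (XX (NN n k)))"
  using block_perms_bij_betw[OF assms NN_positive]
  by (auto simp: BijGroup_def Bij_def XX_def atLeast0LessThan bij_betw_restrict_eq)

lemma perm_embed_restrict:
  assumes "k \<le> j" "f \<in> block_perms (NN n k)"
  shows "perm_embed n k j (restrict f (XX (NN n k))) = restrict f (XX (NN n j))"
proof
  fix x
  show "perm_embed n k j (restrict f (XX (NN n k))) x = restrict f (XX (NN n j)) x"
    using block_perms_ext[OF assms(2), of x] NN_positive[of k]
    by (simp add: perm_embed_def XX_def periodic_ext_def)
qed

text \<open>
  A permutation belongs to many stages; the choice of one of them does not affect the class
  (\<open>to_limit_eq\<close>), because the connecting maps extend periodically
  (\<open>perm_embed_restrict\<close>).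
\<close>
definition to_limit :: "(nat \<Rightarrow> nat) \<Rightarrow> (nat \<times> (nat \<Rightarrow> nat)) set"
  where "to_limit f = (let k = (SOME k. k \<ge> 1 \<and> f \<in> block_perms (NN n k))
    in D.cls k (restrict f (XX (NN n k))))"

lemma to_limit_eq:
  assumes "k \<ge> 1" "f \<in> block_perms (NN n k)"
  shows "to_limit f = D.cls k (restrict f (XX (NN n k)))"
proof -
  define j where "j = (SOME k. k \<ge> 1 \<and> f \<in> block_perms (NN n k))"
  have j: "j \<ge> 1" "f \<in> block_perms (NN n j)"
    using someI[of "\<lambda>k. k \<ge> 1 \<and> f \<in> block_perms (NN n k)" k] assms by (auto simp: j_def)
  have late: "D.cls i (restrict f (XX (NN n i))) =
      D.cls (max j k) (restrict f (XX (NN n (max j k))))"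
    if "i \<ge> 1" "i \<le> max j k" "f \<in> block_perms (NN n i)" for i
    using D.class_map[of i "max j k" "restrict f (XX (NN n i))"] that
      perm_embed_restrict[OF that(2,3)] restrict_block_perms[OF that(3)] by simp
  have "D.cls j (restrict f (XX (NN n j))) = D.cls k (restrict f (XX (NN n k)))"
    using late[of j] late[of k] j assms by simp
  then show ?thesis by (simp add: to_limit_def Let_def j_def)
qed

lemma restrict_eq_imp_eq:
  assumes "f \<in> block_perms (NN n k)" "g \<in> block_perms (NN n k)"
    and "restrict f (XX (NN n k)) = restrict g (XX (NN n k))"
  shows "f = g"
proof
  fix x
  have "x mod NN n k \<in> XX (NN n k)" using NN_positive by (simp add: XX_def)
  then have "f (x mod NN n k) = g (x mod NN n k)" using assms(3) by (metis restrict_apply')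
  then show "f x = g x"
    using block_perms_ext[OF assms(1), of x] block_perms_ext[OF assms(2), of x]
    by (simp add: periodic_ext_def)
qed

lemma perm_limit_iso: "perm_limit n \<cong> lim_sym_group n"
proof (rule is_isoI, rule isoI)
  have L: "lim_sym_group n = D.L" by (simp add: lim_sym_group_def)
  have stage: "\<exists>k\<ge>1. f \<in> block_perms (NN n k) \<and> g \<in> block_perms (NN n k)"
    if "f \<in> carrier (perm_limit n)" "g \<in> carrier (perm_limit n)" for f g
    using common_block_stage[of "{f, g}" n] that by auto
  have closed: "to_limit f \<in> carrier (lim_sym_group n)" if f: "f \<in> carrier (perm_limit n)" for f
  proof -
    obtain k where k: "k \<ge> 1" "f \<in> block_perms (NN n k)"
      using f by (auto simp: carrier_perm_limit)
    then show ?thesis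
      unfolding L D.carrier_ind_lim to_limit_eq[OF k]
      using restrict_block_perms[OF k(2)] k(1) by auto
  qed
  show "to_limit \<in> hom (perm_limit n) (lim_sym_group n)"
  proof (rule homI)
    show "to_limit f \<in> carrier (lim_sym_group n)" if "f \<in> carrier (perm_limit n)" for f
      using that by (rule closed)
  next
    fix f g assume "f \<in> carrier (perm_limit n)" "g \<in> carrier (perm_limit n)"
    then obtain k where k: "k \<ge> 1" "f \<in> block_perms (NN n k)" "g \<in> block_perms (NN n k)"
      using stage by blast
    note fg = comp_block_perms[OF k(2,3)]
    note r = restrict_block_perms[OF k(2)] restrict_block_perms[OF k(3)]
    have "g x \<in> XX (NN n k)" if "x \<in> XX (NN n k)" for x
      using that block_perms_less_iff[OF k(3) NN_positive] by (simp add: XX_def)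
    then have "restrict f (XX (NN n k)) \<otimes>\<^bsub>BijGroup (XX (NN n k))\<^esub> restrict g (XX (NN n k)) =
        restrict (f \<circ> g) (XX (NN n k))"
      using r by (auto simp: BijGroup_def compose_def)
    then show "to_limit (f \<otimes>\<^bsub>perm_limit n\<^esub> g) = to_limit f \<otimes>\<^bsub>lim_sym_group n\<^esub> to_limit g"
      using k fg r by (simp add: to_limit_eq L D.mult_class_same)
  qed
  show "bij_betw to_limit (carrier (perm_limit n)) (carrier (lim_sym_group n))"
  proof (rule bij_betwI')
    fix f g assume "f \<in> carrier (perm_limit n)" "g \<in> carrier (perm_limit n)"
    then obtain k where k: "k \<ge> 1" "f \<in> block_perms (NN n k)" "g \<in> block_perms (NN n k)"
      using stage by blast
    show "to_limit f = to_limit g \<longleftrightarrow> f = g"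
    proof
      assume "to_limit f = to_limit g"
      then obtain l where l: "k \<le> l" "perm_embed n k l (restrict f (XX (NN n k))) =
          perm_embed n k l (restrict g (XX (NN n k)))"
        using k restrict_block_perms by (auto simp: to_limit_eq D.class_eq_iff)
      then show "f = g"
        using restrict_eq_imp_eq[of f l g] perm_embed_restrict[OF l(1)] k
          block_perms_NN_mono[OF l(1)] by simp
    qed simp
  next
    show "to_limit f \<in> carrier (lim_sym_group n)" if "f \<in> carrier (perm_limit n)" for f
      using that by (rule closed)
  next
    fix A assume "A \<in> carrier (lim_sym_group n)"
    then obtain k \<sigma> where k: "k \<ge> 1" "\<sigma> \<in> carrier (BijGroup (XX (NN n k)))" "A = D.cls k \<sigma>"
      unfolding L D.carrier_ind_lim by auto
    then have \<sigma>: "\<sigma> \<in> Bij (XX (NN n k))" by (simp add: BijGroup_def)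
    define f where "f = periodic_ext (NN n k) \<sigma>"
    have f: "f \<in> block_perms (NN n k)"
      unfolding f_def using \<sigma> NN_positive
      by (intro periodic_ext_block_perms) (auto simp: Bij_def XX_def atLeast0LessThan)
    have "restrict f (XX (NN n k)) = \<sigma>"
      using \<sigma> by (auto simp: f_def XX_def periodic_ext_eq Bij_def extensional_def)
    then show "\<exists>f\<in>carrier (perm_limit n). A = to_limit f"
      using k f by (auto intro!: bexI[of _ f] perm_limit_stage simp: to_limit_eq)
  qed
qed

end


section \<open>Elements whose centralizer splits\<close>

definition commutant :: "('a, 'b) monoid_scheme \<Rightarrow> 'a \<Rightarrow> 'a set"
  where "commutant G t = {x \<in> carrier G. x \<otimes>\<^bsub>G\<^esub> t = t \<otimes>\<^bsub>G\<^esub> x}"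

text \<open>
  In a group, \<open>c\<close> is the conjugate \<open>gag\<inverse>\<close> for some
  \<open>g\<close> in the centralizer of \<open>t\<close>. The equation avoids the inverse, which
  makes it immediate to transport and to verify for compositions of functions.
\<close>
definition conj_by_commutant :: "('a, 'b) monoid_scheme \<Rightarrow> 'a \<Rightarrow> 'a \<Rightarrow> 'a \<Rightarrow> bool"
  where "conj_by_commutant G t a c \<longleftrightarrow>
    c \<in> commutant G t \<and> (\<exists>g\<in>commutant G t. c \<otimes>\<^bsub>G\<^esub> g = g \<otimes>\<^bsub>G\<^esub> a)"

text \<open>
  The normal closures of \<open>a\<close> and \<open>b\<close> in the centralizer of
  \<open>t\<close> are both nonabelian and commute with each other. Restricting to nonabelian
  ones is essential: the powers of \<open>t\<close> are central in its centralizer, so without it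
  every \<open>t\<close> would qualify.
\<close>
definition split_centralizer :: "('a, 'b) monoid_scheme \<Rightarrow> 'a \<Rightarrow> bool"
  where "split_centralizer G t \<longleftrightarrow> (\<exists>a\<in>commutant G t. \<exists>b\<in>commutant G t.
    (\<exists>c. conj_by_commutant G t a c \<and> c \<otimes>\<^bsub>G\<^esub> a \<noteq> a \<otimes>\<^bsub>G\<^esub> c) \<and>
    (\<exists>c. conj_by_commutant G t b c \<and> c \<otimes>\<^bsub>G\<^esub> b \<noteq> b \<otimes>\<^bsub>G\<^esub> c) \<and>
    (\<forall>c. conj_by_commutant G t a c \<longrightarrow> c \<otimes>\<^bsub>G\<^esub> b = b \<otimes>\<^bsub>G\<^esub> c))"

text \<open>
  For positive \<open>q\<close> the condition on the powers of \<open>s\<close> means that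
  \<open>s\<close> has order \<open>q\<close>.
\<close>
definition has_unsplit_element :: "('a, 'b) monoid_scheme \<Rightarrow> nat \<Rightarrow> bool"
  where "has_unsplit_element G q \<longleftrightarrow> (\<exists>s\<in>carrier G.
    (\<forall>i::nat. s [^]\<^bsub>G\<^esub> i = \<one>\<^bsub>G\<^esub> \<longleftrightarrow> q dvd i) \<and> \<not> split_centralizer G s)"

lemma split_centralizer_iso:
  assumes "group G" "group H" and h: "h \<in> iso G H"
    and t: "t \<in> carrier G" and split: "split_centralizer G t"
  shows "split_centralizer H (h t)"
proof -
  interpret G: group G by fact
  interpret H: group H by fact
  have mult: "h (x \<otimes>\<^bsub>G\<^esub> y) = h x \<otimes>\<^bsub>H\<^esub> h y" if "x \<in> carrier G" "y \<in> carrier G" for x y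
    using h that by (auto simp: iso_def hom_def)
  have cl: "h x \<in> carrier H" if "x \<in> carrier G" for x
    using h that by (auto simp: iso_def hom_def)
  have inj: "h x = h y \<longleftrightarrow> x = y" if "x \<in> carrier G" "y \<in> carrier G" for x y
    using h that by (auto simp: iso_def bij_betw_def inj_on_def)
  have surj: "\<exists>x\<in>carrier G. h x = y" if "y \<in> carrier H" for y
  proof -
    have "y \<in> h ` carrier G" using h that by (simp add: iso_def bij_betw_def)
    then show ?thesis by blast
  qed
  have comm: "h x \<otimes>\<^bsub>H\<^esub> h y = h y \<otimes>\<^bsub>H\<^esub> h x \<longleftrightarrow> x \<otimes>\<^bsub>G\<^esub> y = y \<otimes>\<^bsub>G\<^esub> x"
    if "x \<in> carrier G" "y \<in> carrier G" for x y
    using that by (simp add: mult[symmetric] inj)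
  have C: "h x \<in> commutant H (h t) \<longleftrightarrow> x \<in> commutant G t" if "x \<in> carrier G" for x
    using that t by (simp add: commutant_def comm cl)
  have CG: "x \<in> carrier G" if "x \<in> commutant G s" for x s
    using that by (simp add: commutant_def)
  have K: "conj_by_commutant H (h t) (h a) (h c) \<longleftrightarrow> conj_by_commutant G t a c"
    if ac: "a \<in> carrier G" "c \<in> carrier G" for a c
  proof -
    have eq: "h c \<otimes>\<^bsub>H\<^esub> h g = h g \<otimes>\<^bsub>H\<^esub> h a \<longleftrightarrow> c \<otimes>\<^bsub>G\<^esub> g = g \<otimes>\<^bsub>G\<^esub> a" if "g \<in> carrier G" for g
      using that ac by (simp add: mult[symmetric] inj)
    have "(\<exists>g\<in>commutant H (h t). h c \<otimes>\<^bsub>H\<^esub> g = g \<otimes>\<^bsub>H\<^esub> h a) \<longleftrightarrow>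
        (\<exists>g\<in>commutant G t. c \<otimes>\<^bsub>G\<^esub> g = g \<otimes>\<^bsub>G\<^esub> a)"
    proof
      assume "\<exists>g\<in>commutant H (h t). h c \<otimes>\<^bsub>H\<^esub> g = g \<otimes>\<^bsub>H\<^esub> h a"
      then obtain g' where g': "g' \<in> commutant H (h t)" "h c \<otimes>\<^bsub>H\<^esub> g' = g' \<otimes>\<^bsub>H\<^esub> h a" by blast
      then obtain g where "g \<in> carrier G" "g' = h g"
        using surj[of g'] by (auto simp: commutant_def)
      then show "\<exists>g\<in>commutant G t. c \<otimes>\<^bsub>G\<^esub> g = g \<otimes>\<^bsub>G\<^esub> a" using g' C eq by blast
    next
      assume "\<exists>g\<in>commutant G t. c \<otimes>\<^bsub>G\<^esub> g = g \<otimes>\<^bsub>G\<^esub> a"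
      then show "\<exists>g\<in>commutant H (h t). h c \<otimes>\<^bsub>H\<^esub> g = g \<otimes>\<^bsub>H\<^esub> h a" using C eq CG by blast
    qed
    then show ?thesis using C[OF ac(2)] by (simp add: conj_by_commutant_def)
  qed
  have KG: "c \<in> carrier M" if "conj_by_commutant M s a c" for M :: "('x, 'y) monoid_scheme" and s a c
    using that by (simp add: conj_by_commutant_def commutant_def)
  obtain a b c d where *: "a \<in> commutant G t" "b \<in> commutant G t"
      "conj_by_commutant G t a c" "c \<otimes>\<^bsub>G\<^esub> a \<noteq> a \<otimes>\<^bsub>G\<^esub> c"
      "conj_by_commutant G t b d" "d \<otimes>\<^bsub>G\<^esub> b \<noteq> b \<otimes>\<^bsub>G\<^esub> d"
      "\<And>c. conj_by_commutant G t a c \<Longrightarrow> c \<otimes>\<^bsub>G\<^esub> b = b \<otimes>\<^bsub>G\<^esub> c"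
    using split unfolding split_centralizer_def by blast
  note cs = CG[OF *(1)] CG[OF *(2)] KG[OF *(3)] KG[OF *(5)]
  have "x \<otimes>\<^bsub>H\<^esub> h b = h b \<otimes>\<^bsub>H\<^esub> x" if x: "conj_by_commutant H (h t) (h a) x" for x
  proof -
    obtain c where c: "c \<in> carrier G" "x = h c" using surj[OF KG[OF x]] by blast
    then show ?thesis using x *(7)[of c] K[OF cs(1) c(1)] comm[OF c(1) cs(2)] by simp
  qed
  moreover have "h c \<otimes>\<^bsub>H\<^esub> h a \<noteq> h a \<otimes>\<^bsub>H\<^esub> h c" "h d \<otimes>\<^bsub>H\<^esub> h b \<noteq> h b \<otimes>\<^bsub>H\<^esub> h d"
    using * cs comm by simp_all
  moreover have "conj_by_commutant H (h t) (h a) (h c)" "conj_by_commutant H (h t) (h b) (h d)"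
    using * cs K by simp_all
  moreover have "h a \<in> commutant H (h t)" "h b \<in> commutant H (h t)" using * cs C by simp_all
  ultimately show ?thesis unfolding split_centralizer_def by blast
qed

lemma has_unsplit_element_iso:
  assumes "group G" "group H" and iso: "G \<cong> H" and unsplit: "has_unsplit_element G q"
  shows "has_unsplit_element H q"
proof -
  interpret G: group G by fact
  interpret H: group H by fact
  obtain h where h: "h \<in> iso G H" using iso by (auto simp: is_iso_def)
  interpret h: group_hom G H h
    using h by unfold_locales (simp add: iso_def)
  have bij: "bij_betw h (carrier G) (carrier H)" using h by (simp add: iso_def)
  obtain s where s: "s \<in> carrier G" "\<And>i::nat. s [^]\<^bsub>G\<^esub> i = \<one>\<^bsub>G\<^esub> \<longleftrightarrow> q dvd i"
      "\<not> split_centralizer G s"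
    using unsplit by (auto simp: has_unsplit_element_def)
  have "h s [^]\<^bsub>H\<^esub> i = \<one>\<^bsub>H\<^esub> \<longleftrightarrow> q dvd i" for i :: nat
  proof -
    have "h s [^]\<^bsub>H\<^esub> i = h (s [^]\<^bsub>G\<^esub> i)" using s(1) by (simp add: h.hom_nat_pow)
    moreover have "h (s [^]\<^bsub>G\<^esub> i) = h \<one>\<^bsub>G\<^esub> \<longleftrightarrow> s [^]\<^bsub>G\<^esub> i = \<one>\<^bsub>G\<^esub>"
      using inj_on_eq_iff[OF bij_betw_imp_inj_on[OF bij], of "s [^]\<^bsub>G\<^esub> i" "\<one>\<^bsub>G\<^esub>"] s(1) by simp
    ultimately show ?thesis using s(2) by simp
  qed
  moreover have "\<not> split_centralizer H (h s)"
  proof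
    assume "split_centralizer H (h s)"
    then have "split_centralizer G (inv_into (carrier G) h (h s))"
      using split_centralizer_iso[OF assms(2,1) G.iso_set_sym[OF h]] s(1) by simp
    then show False using s bij by (simp add: bij_betw_def)
  qed
  moreover have "h s \<in> carrier H" using s(1) by simp
  ultimately show ?thesis unfolding has_unsplit_element_def by blast
qed


section \<open>Permutations with cycles of different lengths\<close>

lemma commute_funpow:
  assumes "f \<circ> t = t \<circ> f"
  shows "f ((t ^^ i) x) = (t ^^ i) (f x)"
proof (induction i)
  case (Suc i)
  have "f (t y) = t (f y)" for y using assms by (metis comp_apply)
  then show ?case using Suc by simp
qed simp

text \<open>
  The intervals of length \<open>N\<close> are copies of \<open>{0..<N}\<close>. The permutation
  \<open>\<pi>\<close> of the copies is applied to the points of \<open>A\<close> only; for a set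
  \<open>A\<close> that is invariant under the shift by \<open>N\<close> this is a permutation
  again, and it depends multiplicatively on \<open>\<pi>\<close>.
\<close>
definition copy_perm :: "nat set \<Rightarrow> nat \<Rightarrow> (nat \<Rightarrow> nat) \<Rightarrow> nat \<Rightarrow> nat"
  where "copy_perm A N \<pi> x = (if x \<in> A then x mod N + N * \<pi> (x div N) else x)"

context
  fixes A :: "nat set" and N :: nat
  assumes N: "N > 0" and A: "\<And>x. x mod N \<in> A \<longleftrightarrow> x \<in> A"
begin

lemma copy_in: "x mod N + N * y \<in> A \<longleftrightarrow> x \<in> A"
  using A[of "x mod N + N * y"] A[of x] by simp

lemma copy_perm_in: "copy_perm A N \<pi> x \<in> A \<longleftrightarrow> x \<in> A"
  by (simp add: copy_perm_def copy_in)

lemma copy_perm_comp: "copy_perm A N \<pi> \<circ> copy_perm A N \<pi>' = copy_perm A N (\<pi> \<circ> \<pi>')"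
  using N by (auto simp: copy_perm_def fun_eq_iff copy_in)

lemma copy_perm_id: "copy_perm A N id = id"
  by (auto simp: copy_perm_def fun_eq_iff)

lemma copy_perm_block_perms:
  assumes \<pi>: "\<pi> \<in> block_perms r"
  shows "copy_perm A N \<pi> \<in> block_perms (N * r)"
proof -
  have "\<pi> \<circ> inv_into UNIV \<pi> = id" "inv_into UNIV \<pi> \<circ> \<pi> = id"
    using block_perms_bij[OF \<pi>] by (auto simp: bij_is_inj bij_is_surj surj_iff[symmetric])
  then have "bij (copy_perm A N \<pi>)"
    using copy_perm_comp copy_perm_id by (intro o_bij[of "copy_perm A N (inv_into UNIV \<pi>)"]) simp_all
  moreover have "copy_perm A N \<pi> x div (N * r) = x div (N * r)" for x
    using N block_perms_div[OF \<pi>] by (simp add: copy_perm_def div_mult2_eq)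
  moreover have "copy_perm A N \<pi> (x + N * r) = copy_perm A N \<pi> x + N * r" for x
  proof -
    have "x + N * r \<in> A \<longleftrightarrow> x \<in> A" using A[of "x + N * r"] A[of x] by simp
    moreover have "\<pi> (x div N + r) = \<pi> (x div N) + r" using \<pi> by (simp add: block_perms_def)
    ultimately show ?thesis using N by (simp add: copy_perm_def algebra_simps)
  qed
  ultimately show ?thesis by (simp add: block_perms_def)
qed

text \<open>
  An \<open>N\<close>-periodic \<open>t\<close> acts on all copies in the same way, so it does
  not see how they are permuted.
\<close>
lemma copy_perm_commute:
  assumes t: "t \<in> block_perms N" and tA: "\<And>x. t x \<in> A \<longleftrightarrow> x \<in> A"
  shows "copy_perm A N \<pi> \<circ> t = t \<circ> copy_perm A N \<pi>"
proof
  fix x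
  have "t (x mod N + N * \<pi> (x div N)) = t x mod N + N * \<pi> (x div N)"
    using block_perms_shift[OF t] block_perms_mod[OF t N, of x] by simp
  then show "(copy_perm A N \<pi> \<circ> t) x = (t \<circ> copy_perm A N \<pi>) x"
    using block_perms_div[OF t, of x] tA[of x] by (simp add: copy_perm_def)
qed

text \<open>
  Three copies suffice: on the points of \<open>A\<close> let \<open>a\<close> exchange the
  copies 0 and 1, and let \<open>g\<close> exchange the copies 1 and 2. Then the conjugate
  \<open>c\<close> of \<open>a\<close> by \<open>g\<close> exchanges the copies 0 and 2, and
  noncommuting transpositions of the copies give noncommuting permutations as soon as
  \<open>A\<close> has a point.
\<close>
lemma copy_perm_noncommuting_conj:
  assumes ne: "A \<noteq> {}" and r: "r > 2"
    and t: "t \<in> block_perms N" and tA: "\<And>x. t x \<in> A \<longleftrightarrow> x \<in> A"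
  obtains a g c where "a \<in> block_perms (N * r)" "g \<in> block_perms (N * r)" "c \<in> block_perms (N * r)"
    "a \<circ> t = t \<circ> a" "g \<circ> t = t \<circ> g" "c \<circ> t = t \<circ> c"
    "c \<circ> g = g \<circ> a" "c \<circ> a \<noteq> a \<circ> c"
    "\<And>x. x \<notin> A \<Longrightarrow> a x = x" "\<And>x. a x \<in> A \<longleftrightarrow> x \<in> A"
proof -
  define p where "p = periodic_ext r (transpose 0 1)"
  define p' where "p' = periodic_ext r (transpose 1 2)"
  have tb: "bij_betw (transpose i j) {..<r} {..<r}" if "i < r" "j < r" for i j
    using that by (intro bij_betw_byWitness[of _ "transpose i j"]) (auto simp: transpose_def)
  have p: "p \<in> block_perms r" and p': "p' \<in> block_perms r"
    using r by (auto simp: p_def p'_def intro!: periodic_ext_block_perms tb)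
  have p'p': "p' \<circ> p' = id"
  proof
    fix x
    have "transpose 1 2 (x mod r) < r" using r by (auto simp: transpose_def)
    then show "(p' \<circ> p') x = id x" by (simp add: p'_def periodic_ext_def)
  qed
  obtain x0 where x0: "x0 < N" "x0 \<in> A"
    using ne A N by (metis ex_in_conv mod_less_divisor)
  have vals: "p 0 = 1" "p 1 = 0" "p 2 = 2" "p' 0 = 0" "p' 1 = 2" "p' 2 = 1"
    using r by (simp_all add: p_def p'_def periodic_ext_eq transpose_def)
  let ?a = "copy_perm A N p" and ?g = "copy_perm A N p'" and ?c = "copy_perm A N (p' \<circ> p \<circ> p')"
  show thesis
  proof (rule that[of ?a ?g ?c])
    show "?c \<circ> ?g = ?g \<circ> ?a" using p'p' by (simp add: copy_perm_comp comp_assoc)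
    have "(?c \<circ> ?a) x0 \<noteq> (?a \<circ> ?c) x0"
      using x0 vals by (simp add: copy_perm_comp) (simp add: copy_perm_def)
    then show "?c \<circ> ?a \<noteq> ?a \<circ> ?c" by metis
    show "?a \<in> block_perms (N * r)" "?g \<in> block_perms (N * r)" "?c \<in> block_perms (N * r)"
      using p p' by (simp_all add: copy_perm_block_perms comp_block_perms)
    show "?a \<circ> t = t \<circ> ?a" "?g \<circ> t = t \<circ> ?g" "?c \<circ> t = t \<circ> ?c"
      using t tA by (simp_all add: copy_perm_commute)
    show "?a x = x" if "x \<notin> A" for x using that by (simp add: copy_perm_def)
    show "?a x \<in> A \<longleftrightarrow> x \<in> A" for x by (rule copy_perm_in)
  qed
qed

end

text \<open>
  The set \<open>A\<close> of points moved by the \<open>i\<close>-th power of \<open>t\<close>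
  is invariant under the centralizer of \<open>t\<close>. Permuting copies of \<open>A\<close>
  and copies of its complement gives the two elements: all conjugates of the first by the
  centralizer are supported in \<open>A\<close>, hence disjointly from the second.
\<close>
lemma split_centralizer_of_unequal_cycles:
  assumes n: "\<And>i. i \<ge> 1 \<Longrightarrow> n i > 1"
    and t: "t \<in> carrier (perm_limit n)"
    and fixed: "(t ^^ i) x = x" and moved: "(t ^^ i) y \<noteq> y"
  shows "split_centralizer (perm_limit n) t"
proof -
  obtain k where k: "k \<ge> 1" "t \<in> block_perms (NN n k)"
    using t by (auto simp: carrier_perm_limit)
  define N where "N = NN n k"
  have N: "N > 0" unfolding N_def using n by (rule NN_pos)
  have tN: "t \<in> block_perms N" using k by (simp add: N_def)
  (* Each further stage at least doubles the number of copies, so two of them yield the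
     three copies that are needed. *)
  define r where "r = n (Suc k) * n (Suc (Suc k))"
  have M: "NN n (Suc (Suc k)) = N * r" by (simp add: NN_def N_def r_def algebra_simps)
  have "2 * 2 \<le> r"
    unfolding r_def using n[of "Suc k"] n[of "Suc (Suc k)"] by (intro mult_le_mono) simp_all
  then have r: "r > 2" by simp
  define A where "A = {x. (t ^^ i) x \<noteq> x}"
  have ti: "t ^^ i \<in> block_perms N" using tN by (rule funpow_block_perms)
  have A: "x mod N \<in> A \<longleftrightarrow> x \<in> A" for x
    using block_perms_ext[OF ti, of x] by (simp add: A_def periodic_ext_def)
       (metis add.commute add_right_cancel mod_mult_div_eq mult.commute)
  have gA: "g x \<in> A \<longleftrightarrow> x \<in> A" if "g \<circ> t = t \<circ> g" "bij g" for g x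
    using inj_eq[OF bij_is_inj[OF that(2)], of "(t ^^ i) x" x] commute_funpow[OF that(1), of i x]
    by (simp add: A_def)
  have tA: "t x \<in> A \<longleftrightarrow> x \<in> A" for x
    using gA[of t x] block_perms_bij[OF tN] by simp
  have stage: "f \<in> carrier (perm_limit n)" if "f \<in> block_perms (N * r)" for f
    using perm_limit_stage[of "Suc (Suc k)" f n] that by (simp add: M)
  have "y \<in> A" "x \<in> - A" using moved fixed by (simp_all add: A_def)
  then have ne: "A \<noteq> {}" "- A \<noteq> {}" by blast+
  obtain a g c where a: "a \<in> block_perms (N * r)" "g \<in> block_perms (N * r)" "c \<in> block_perms (N * r)"
    "a \<circ> t = t \<circ> a" "g \<circ> t = t \<circ> g" "c \<circ> t = t \<circ> c"
    "c \<circ> g = g \<circ> a" "c \<circ> a \<noteq> a \<circ> c"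
    "\<And>x. x \<notin> A \<Longrightarrow> a x = x" "\<And>x. a x \<in> A \<longleftrightarrow> x \<in> A"
    by (rule copy_perm_noncommuting_conj[OF N A ne(1) r tN tA]) blast
  have A': "x mod N \<in> - A \<longleftrightarrow> x \<in> - A" and tA': "t x \<in> - A \<longleftrightarrow> x \<in> - A" for x
    using A tA by simp_all
  obtain b h d where b: "b \<in> block_perms (N * r)" "h \<in> block_perms (N * r)" "d \<in> block_perms (N * r)"
    "b \<circ> t = t \<circ> b" "h \<circ> t = t \<circ> h" "d \<circ> t = t \<circ> d"
    "d \<circ> h = h \<circ> b" "d \<circ> b \<noteq> b \<circ> d"
    "\<And>x. x \<notin> - A \<Longrightarrow> b x = x" "\<And>x. b x \<in> - A \<longleftrightarrow> x \<in> - A"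
    by (rule copy_perm_noncommuting_conj[OF N A' ne(2) r tN tA']) blast
  have C: "f \<in> commutant (perm_limit n) t \<longleftrightarrow> f \<in> carrier (perm_limit n) \<and> f \<circ> t = t \<circ> f" for f
    by (simp add: commutant_def)
  have "e \<circ> b = b \<circ> e" if e: "conj_by_commutant (perm_limit n) t a e" for e
  proof
    fix x
    obtain u where u: "u \<in> carrier (perm_limit n)" "u \<circ> t = t \<circ> u" "e \<circ> u = u \<circ> a"
      using e by (auto simp: conj_by_commutant_def C)
    have bu: "bij u" using u(1) by (rule bij_of_perm_limit)
    have e_out: "e x = x" if "x \<notin> A" for x
    proof -
      obtain z where z: "x = u z" using bij_is_surj[OF bu] by blast
      have "e x = u (a z)" using u(3) z by (metis comp_apply)
      moreover have "z \<notin> A" using that z gA[OF u(2) bu, of z] by simp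
      ultimately show ?thesis using a(9) z by simp
    qed
    have e_in: "e x \<in> A" if "x \<in> A" for x
    proof -
      obtain z where z: "x = u z" using bij_is_surj[OF bu] by blast
      have "e x = u (a z)" using u(3) z by (metis comp_apply)
      moreover have "z \<in> A" using that z gA[OF u(2) bu, of z] by simp
      ultimately show ?thesis using a(10) gA[OF u(2) bu] by simp
    qed
    show "(e \<circ> b) x = (b \<circ> e) x"
      using e_in[of x] e_out[of x] e_out[of "b x"] b(9)[of x] b(9)[of "e x"] b(10)[of x]
      by (cases "x \<in> A") simp_all
  qed
  moreover have "conj_by_commutant (perm_limit n) t a c" "conj_by_commutant (perm_limit n) t b d"
    using a b stage by (auto simp: conj_by_commutant_def C)
  moreover have "a \<in> commutant (perm_limit n) t" "b \<in> commutant (perm_limit n) t"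
    using a b stage by (auto simp: C)
  ultimately show ?thesis
    unfolding split_centralizer_def perm_limit_simps using a(8) b(8) by blast
qed


section \<open>Permutations all of whose cycles have the same length\<close>

definition uniform_cycles :: "nat \<Rightarrow> (nat \<Rightarrow> nat) \<Rightarrow> bool"
  where "uniform_cycles q t \<longleftrightarrow> bij t \<and> q > 0 \<and> (\<forall>i x. (t ^^ i) x = x \<longleftrightarrow> q dvd i)"

definition cycle_of :: "(nat \<Rightarrow> nat) \<Rightarrow> nat \<Rightarrow> nat set"
  where "cycle_of t x = range (\<lambda>i. (t ^^ i) x)"

lemma in_cycle_of: "y \<in> cycle_of t x \<longleftrightarrow> (\<exists>i. y = (t ^^ i) x)"
  by (auto simp: cycle_of_def)

lemma funpow_in_cycle_of: "(t ^^ i) x \<in> cycle_of t x"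
  by (auto simp: cycle_of_def)

lemma self_in_cycle_of: "x \<in> cycle_of t x"
  using funpow_in_cycle_of[of 0 t x] by simp

lemma cycle_of_trans: "y \<in> cycle_of t x \<Longrightarrow> z \<in> cycle_of t y \<Longrightarrow> z \<in> cycle_of t x"
proof -
  assume "y \<in> cycle_of t x" "z \<in> cycle_of t y"
  then obtain i j where "y = (t ^^ i) x" "z = (t ^^ j) y" by (auto simp: in_cycle_of)
  then have "z = (t ^^ (j + i)) x" by (simp add: funpow_add)
  then show "z \<in> cycle_of t x" unfolding in_cycle_of by blast
qed

lemma cycle_of_commute:
  assumes "f \<circ> t = t \<circ> f" "y \<in> cycle_of t x"
  shows "f y \<in> cycle_of t (f x)"
  using assms(2) commute_funpow[OF assms(1)] by (auto simp: in_cycle_of)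

lemma cycle_of_less:
  assumes "t \<in> block_perms M" "x < M" "y \<in> cycle_of t x"
  shows "y < M"
  using assms(3) block_perms_less_iff[OF funpow_block_perms[OF assms(1)]] assms(2)
  by (auto simp: in_cycle_of)

context
  fixes q :: nat and t :: "nat \<Rightarrow> nat"
  assumes u: "uniform_cycles q t"
begin

lemma funpow_eq_self_iff: "(t ^^ i) x = x \<longleftrightarrow> q dvd i"
  using u by (simp add: uniform_cycles_def)

lemma uniform_pos: "q > 0"
  using u by (simp add: uniform_cycles_def)

lemma funpow_eq_iff: "(t ^^ i) x = (t ^^ j) x \<longleftrightarrow> i mod q = j mod q"
proof -
  have *: "(t ^^ i) x = (t ^^ j) x \<longleftrightarrow> i mod q = j mod q" if "i \<le> j" for i j
  proof -
    have "bij (t ^^ i)" using u by (simp add: uniform_cycles_def bij_betw_funpow)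
    then have inj: "inj (t ^^ i)" by (rule bij_is_inj)
    have "(t ^^ j) x = (t ^^ i) ((t ^^ (j - i)) x)"
      using that funpow_add[of i "j - i" t] by (simp add: fun_eq_iff)
    then have "(t ^^ i) x = (t ^^ j) x \<longleftrightarrow> (t ^^ (j - i)) x = x"
      using inj_eq[OF inj] by metis
    also have "\<dots> \<longleftrightarrow> q dvd j - i" by (rule funpow_eq_self_iff)
    also have "\<dots> \<longleftrightarrow> i mod q = j mod q" using mod_eq_dvd_iff_nat[OF that, of q] by auto
    finally show ?thesis .
  qed
  show ?thesis using *[of i j] *[of j i] by (cases "i \<le> j") auto
qed

lemma cycle_of_eq_image: "cycle_of t x = (\<lambda>i. (t ^^ i) x) ` {..<q}"
proof
  show "cycle_of t x \<subseteq> (\<lambda>i. (t ^^ i) x) ` {..<q}"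
  proof
    fix y assume "y \<in> cycle_of t x"
    then obtain i where "y = (t ^^ i) x" by (auto simp: in_cycle_of)
    then have "y = (t ^^ (i mod q)) x" using funpow_eq_iff[of i x "i mod q"] by simp
    then show "y \<in> (\<lambda>i. (t ^^ i) x) ` {..<q}" using uniform_pos by simp
  qed
qed (auto simp: cycle_of_def)

lemma finite_cycle_of: "finite (cycle_of t x)"
  by (simp add: cycle_of_eq_image)

lemma card_cycle_of: "card (cycle_of t x) = q"
proof -
  have "inj_on (\<lambda>i. (t ^^ i) x) {..<q}" by (rule inj_onI) (simp add: funpow_eq_iff)
  then show ?thesis by (simp add: cycle_of_eq_image card_image)
qed

lemma cycle_of_sym: "y \<in> cycle_of t x \<longleftrightarrow> x \<in> cycle_of t y"
proof -
  have "x \<in> cycle_of t y" if y: "y \<in> cycle_of t x" for x y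
  proof -
    obtain i where i: "i < q" "y = (t ^^ i) x" using y by (auto simp: cycle_of_eq_image)
    then have "(t ^^ (q - i)) y = (t ^^ q) x"
      using funpow_add[of "q - i" i t] by (simp add: fun_eq_iff)
    then have "x = (t ^^ (q - i)) y" using funpow_eq_self_iff[of q x] by simp
    then show ?thesis unfolding in_cycle_of by blast
  qed
  then show ?thesis by blast
qed

text \<open>
  The cycles partition \<open>{0..<N}\<close> into classes of \<open>q\<close> elements each.
\<close>
lemma uniform_cycles_dvd:
  assumes t: "t \<in> block_perms N" and N: "N > 0"
  shows "q dvd N"
proof -
  let ?r = "{(x, y). x < N \<and> y \<in> cycle_of t x}"
  have less: "y < N" if "x < N" "y \<in> cycle_of t x" for x y
    using cycle_of_less[OF t that] .
  have "equiv {..<N} ?r"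
  proof (rule equivI)
    show "?r \<subseteq> {..<N} \<times> {..<N}" using less by auto
    show "refl_on {..<N} ?r" by (auto simp: refl_on_def self_in_cycle_of)
    show "sym ?r" using less cycle_of_sym by (auto simp: sym_def)
    show "trans ?r" using cycle_of_trans by (auto simp: trans_def)
  qed
  then have "q dvd card {..<N}"
  proof (rule equiv_imp_dvd_card[rotated])
    fix X assume "X \<in> {..<N} // ?r"
    then obtain x where "x < N" "X = cycle_of t x" by (auto simp: quotient_def)
    then show "q dvd card X" by (simp add: card_cycle_of)
  qed simp
  then show ?thesis by simp
qed

text \<open>
  Since all cycles have the same length, two of them can be exchanged by matching
  \<open>t\<^sup>i x\<close> with \<open>t\<^sup>i y\<close>. The exchange is carried out inside
  \<open>{0..<M}\<close> and repeated periodically, so only the points below \<open>M\<close>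
  outside the two cycles are claimed to be fixed.
\<close>
lemma cycle_swap_exists:
  assumes t: "t \<in> block_perms M" and xM: "x < M" and yM: "y < M" and xy: "y \<notin> cycle_of t x"
  obtains g where "g \<in> block_perms M" "g \<circ> t = t \<circ> g" "g \<circ> g = id" "g x = y" "g y = x"
    "\<And>z. z < M \<Longrightarrow> z \<notin> cycle_of t x \<Longrightarrow> z \<notin> cycle_of t y \<Longrightarrow> g z = z"
proof -
  have M: "M > 0" using xM by simp
  (* The exponent is determined only modulo q, but so is its effect on any other point; hence
     the choice is harmless. *)
  define g0 where "g0 z =
    (if z \<in> cycle_of t x then (t ^^ (SOME i. z = (t ^^ i) x)) y
     else if z \<in> cycle_of t y then (t ^^ (SOME i. z = (t ^^ i) y)) x else z)" for z
  have some: "(t ^^ (SOME j. (t ^^ i) u = (t ^^ j) u)) v = (t ^^ i) v" for i u v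
  proof -
    have "(t ^^ i) u = (t ^^ (SOME j. (t ^^ i) u = (t ^^ j) u)) u"
      by (rule someI[of "\<lambda>j. (t ^^ i) u = (t ^^ j) u" i]) simp
    then show ?thesis by (metis funpow_eq_iff)
  qed
  have gx: "g0 ((t ^^ i) x) = (t ^^ i) y" for i
    by (simp add: g0_def funpow_in_cycle_of some)
  have "(t ^^ i) y \<notin> cycle_of t x" for i
    using xy cycle_of_trans cycle_of_sym funpow_in_cycle_of by metis
  then have gy: "g0 ((t ^^ i) y) = (t ^^ i) x" for i
    by (simp add: g0_def funpow_in_cycle_of some)
  have gz: "g0 z = z" if "z \<notin> cycle_of t x" "z \<notin> cycle_of t y" for z
    using that by (simp add: g0_def)
  have cases: "(\<exists>i. z = (t ^^ i) x) \<or> (\<exists>i. z = (t ^^ i) y) \<or>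
      (z \<notin> cycle_of t x \<and> z \<notin> cycle_of t y)" for z
    by (auto simp: in_cycle_of)
  have g0g0: "g0 (g0 z) = z" for z
    using cases[of z] gx gy gz by auto
  have g0t: "g0 (t z) = t (g0 z)" for z
  proof -
    have "t z \<notin> cycle_of t w" if "z \<notin> cycle_of t w" for w
      using that cycle_of_trans[of "t z" t w z] cycle_of_sym[of "t z" z]
        funpow_in_cycle_of[of 1 t z] by auto
    then show ?thesis
      using cases[of z] gx[of "Suc _"] gy[of "Suc _"] gx gy gz by auto
  qed
  have g0M: "g0 z < M" if "z < M" for z
  proof -
    have "(t ^^ i) x < M" "(t ^^ i) y < M" for i
      using cycle_of_less[OF t] xM yM funpow_in_cycle_of by blast+
    then show ?thesis using cases[of z] gx gy gz that by auto
  qed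
  have bij: "bij_betw g0 {..<M} {..<M}"
    using g0g0 g0M by (intro bij_betw_byWitness[of _ g0]) auto
  define g where "g = periodic_ext M g0"
  have g: "g \<in> block_perms M" unfolding g_def using M bij by (rule periodic_ext_block_perms)
  have gg0: "g z = g0 z" if "z < M" for z using that by (simp add: g_def periodic_ext_eq)
  have gext: "g z = g0 (z mod M) + M * (z div M)" for z by (simp add: g_def periodic_ext_def)
  have "g \<circ> t = t \<circ> g"
  proof
    fix z
    have "g (t z) = g0 (t (z mod M)) + M * (z div M)"
      using block_perms_mod[OF t M, of z] block_perms_div[OF t, of z] by (simp add: gext)
    also have "\<dots> = t (g z)" by (simp add: g0t gext block_perms_shift[OF t])
    finally show "(g \<circ> t) z = (t \<circ> g) z" by simp
  qed
  moreover have "g \<circ> g = id"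
  proof
    fix z
    have "g0 (z mod M) < M" using g0M M by simp
    then show "(g \<circ> g) z = id z" by (simp add: gext g0g0)
  qed
  moreover have "g x = y" "g y = x" using gx[of 0] gy[of 0] gg0 xM yM by simp_all
  ultimately show thesis using that[of g] g gg0 gz by simp
qed

text \<open>
  On each cycle \<open>a\<close> acts as a power of \<open>t\<close>. A conjugate of
  \<open>a\<close> by a permutation commuting with \<open>t\<close> does so too, and powers of
  \<open>t\<close> commute.
\<close>
lemma commute_of_cycle_preserving:
  assumes a: "a \<circ> t = t \<circ> a" "\<And>x. a x \<in> cycle_of t x"
    and c: "c \<circ> t = t \<circ> c" and g: "g \<circ> t = t \<circ> g" "bij g" "c \<circ> g = g \<circ> a"
  shows "c \<circ> a = a \<circ> c"
proof
  fix x
  obtain y where y: "x = g y" using bij_is_surj[OF g(2)] by blast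
  obtain i where "a y = (t ^^ i) y" using a(2)[of y] by (auto simp: in_cycle_of)
  then have cx: "c x = (t ^^ i) x"
    using commute_funpow[OF g(1), of i y] fun_cong[OF g(3), of y] by (simp add: y)
  obtain j where ax: "a x = (t ^^ j) x" using a(2)[of x] by (auto simp: in_cycle_of)
  have "c (a x) = (t ^^ j) ((t ^^ i) x)" using commute_funpow[OF c] by (simp add: ax cx)
  also have "\<dots> = (t ^^ i) ((t ^^ j) x)"
    using funpow_add[of i j t] funpow_add[of j i t] by (simp add: fun_eq_iff add.commute)
  also have "\<dots> = a (c x)" using commute_funpow[OF a(1)] by (simp add: ax cx)
  finally show "(c \<circ> a) x = (a \<circ> c) x" by simp
qed

text \<open>
  Every point has infinitely many translates by multiples of \<open>N\<close>, on which
  \<open>a\<close> and \<open>t\<close> behave in the same way.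
\<close>
lemma infinite_cycle_moved:
  assumes "a \<in> block_perms N" "t \<in> block_perms N" "N > 0" and y: "a y \<notin> cycle_of t y"
  shows "infinite {y. a y \<notin> cycle_of t y}"
proof -
  have "a (y + N * i) \<notin> cycle_of t (y + N * i)" for i
    using y block_perms_shift[OF assms(1)] block_perms_shift[OF funpow_block_perms[OF assms(2)]]
    by (simp add: in_cycle_of)
  then have "range (\<lambda>i. y + N * i) \<subseteq> {y. a y \<notin> cycle_of t y}" by auto
  moreover have "infinite (range (\<lambda>i. y + N * i))"
    using assms(3) by (intro range_inj_infinite) (auto simp: inj_def)
  ultimately show ?thesis using infinite_super by blast
qed

text \<open>
  Choose \<open>y\<close>, moved by \<open>a\<close> to another cycle, and \<open>w\<close> such
  that the cycles involved are as distinct as possible; this can be done as only finitely many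
  points are forbidden. Let \<open>g\<close> exchange the cycles of \<open>x\<close> and
  \<open>y\<close> and the cycles of \<open>a y\<close> and \<open>w\<close>. The conjugate
  \<open>c\<close> of \<open>a\<close> by \<open>g\<close> then maps \<open>x\<close> to
  \<open>w\<close>. So \<open>b (c x) = b w\<close>, where \<open>w\<close> is arbitrary up to
  finitely many exclusions, whereas \<open>c (b x)\<close> is the image of \<open>a (b x)\<close>
  under the exchange of the cycles of \<open>x\<close> and \<open>y\<close>, and thus lies in a
  set from which \<open>b w\<close> was kept away.
\<close>
lemma noncommuting_conj:
  assumes n: "\<And>i. i \<ge> 1 \<Longrightarrow> n i > 1"
    and a: "a \<in> carrier (perm_limit n)" "a \<circ> t = t \<circ> a"
    and b: "b \<in> carrier (perm_limit n)" "b \<circ> t = t \<circ> b"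
    and t: "t \<in> carrier (perm_limit n)"
    and a_moves: "a y0 \<notin> cycle_of t y0" and b_moves: "b x \<notin> cycle_of t x"
  shows "\<exists>c. conj_by_commutant (perm_limit n) t a c \<and> c \<circ> b \<noteq> b \<circ> c"
proof -
  obtain k where k: "a \<in> block_perms (NN n k)" "b \<in> block_perms (NN n k)" "t \<in> block_perms (NN n k)"
    using common_block_stage[of "{a, b, t}" n] a(1) b(1) t by auto
  have N: "NN n k > 0" using n by (rule NN_pos)
  have inj_a: "inj a" and inj_b: "inj b" using a(1) b(1) by (simp_all add: bij_of_perm_limit bij_is_inj)
  have "infinite {y. a y \<notin> cycle_of t y}"
    using infinite_cycle_moved[OF k(1,3) N a_moves] .
  moreover have "finite (cycle_of t x \<union> cycle_of t (b x) \<union> cycle_of t (a (b x)) \<union>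
      a -` (cycle_of t x \<union> cycle_of t (b x)))" (is "finite ?F")
    using inj_a by (simp add: finite_cycle_of finite_vimageI)
  ultimately obtain y where y: "a y \<notin> cycle_of t y" "y \<notin> ?F"
    using finite_subset[of "{y. a y \<notin> cycle_of t y}" ?F] by blast
  have "finite (cycle_of t x \<union> cycle_of t (b x) \<union> cycle_of t y \<union> cycle_of t (a y) \<union>
      cycle_of t (a (b x)) \<union> b -` (cycle_of t y \<union> {a (b x)}))" (is "finite ?F'")
    using inj_b by (simp add: finite_cycle_of finite_vimageI)
  then obtain w where w: "w \<notin> ?F'" using ex_new_if_finite[OF infinite_UNIV_nat] by metis
  (* The stage must exceed all points in play, because cycle exchanges are only controlled
     below M; a sum is a convenient upper bound. *)
  define m where "m = k + x + b x + y + a y + w + a (b x)"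
  define M where "M = NN n (Suc m)"
  have km: "k \<le> Suc m" by (simp add: m_def)
  have "Suc m < M" unfolding M_def using n by (rule lt_NN)
  then have lt: "x < M" "b x < M" "y < M" "a y < M" "w < M" "a (b x) < M" by (simp_all add: m_def)
  have ab: "a \<in> block_perms M" "t \<in> block_perms M"
    using k block_perms_NN_mono[OF km] by (simp_all add: M_def)
  have off: "v \<notin> cycle_of t u" if "u \<notin> cycle_of t v" for u v using that cycle_of_sym by blast
  obtain g1 where g1: "g1 \<in> block_perms M" "g1 \<circ> t = t \<circ> g1" "g1 \<circ> g1 = id" "g1 x = y" "g1 y = x"
    "\<And>z. z < M \<Longrightarrow> z \<notin> cycle_of t x \<Longrightarrow> z \<notin> cycle_of t y \<Longrightarrow> g1 z = z"
    using cycle_swap_exists[OF ab(2) lt(1,3)] y(2) by blast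
  obtain g2 where g2: "g2 \<in> block_perms M" "g2 \<circ> t = t \<circ> g2" "g2 \<circ> g2 = id" "g2 (a y) = w" "g2 w = a y"
    "\<And>z. z < M \<Longrightarrow> z \<notin> cycle_of t (a y) \<Longrightarrow> z \<notin> cycle_of t w \<Longrightarrow> g2 z = z"
    using cycle_swap_exists[OF ab(2) lt(4,5)] w by blast
  define g where "g = g1 \<circ> g2"
  define g' where "g' = g2 \<circ> g1"
  define c where "c = g \<circ> a \<circ> g'"
  have g'g: "g' (g z) = z" for z
    using fun_cong[OF g1(3), of "g2 z"] fun_cong[OF g2(3), of z] by (simp add: g_def g'_def)
  have cg: "c \<circ> g = g \<circ> a" by (simp add: c_def fun_eq_iff g'g)
  have t_comm: "g1 (t z) = t (g1 z)" "g2 (t z) = t (g2 z)" "a (t z) = t (a z)" for z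
    using fun_cong[OF g1(2), of z] fun_cong[OF g2(2), of z] fun_cong[OF a(2), of z] by simp_all
  have gt: "g \<circ> t = t \<circ> g" and ct: "c \<circ> t = t \<circ> c"
    by (simp_all add: c_def g_def g'_def fun_eq_iff t_comm)
  have "g \<in> block_perms M" "c \<in> block_perms M"
    using g1(1) g2(1) ab(1) by (simp_all add: c_def g_def g'_def comp_block_perms)
  then have "g \<in> commutant (perm_limit n) t" "c \<in> commutant (perm_limit n) t"
    using perm_limit_stage[of "Suc m" _ n] gt ct by (simp_all add: commutant_def M_def)
  then have "conj_by_commutant (perm_limit n) t a c"
    unfolding conj_by_commutant_def perm_limit_simps using cg by blast
  moreover have "c \<circ> b \<noteq> b \<circ> c"
  proof
    assume eq: "c \<circ> b = b \<circ> c"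
    have "g2 y = y" using g2(6)[OF lt(3)] off y(1) w by blast
    then have "g' x = y" by (simp add: g'_def g1(4))
    moreover have "g1 w = w" using g1(6)[OF lt(5)] w by blast
    ultimately have "b (c x) = b w" by (simp add: c_def g_def g2(4))
    have "g1 (b x) = b x" using g1(6)[OF lt(2)] b_moves off y(2) by blast
    moreover have "g2 (b x) = b x" using g2(6)[OF lt(2)] off y(2) w by blast
    ultimately have "c (b x) = g (a (b x))" by (simp add: c_def g'_def)
    have "a (b x) \<notin> cycle_of t (a y)"
    proof
      assume "a (b x) \<in> cycle_of t (a y)"
      then obtain i where "a (b x) = a ((t ^^ i) y)"
        using commute_funpow[OF a(2)] by (auto simp: in_cycle_of)
      then have "b x \<in> cycle_of t y" using inj_a by (auto simp: in_cycle_of dest: injD)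
      then show False using off y(2) by blast
    qed
    then have "g2 (a (b x)) = a (b x)" using g2(6)[OF lt(6)] off w by blast
    then have key: "b w = g1 (a (b x))"
      using eq \<open>b (c x) = b w\<close> \<open>c (b x) = g (a (b x))\<close> by (metis comp_apply g_def)
    show False
    proof (cases "a (b x) \<in> cycle_of t x")
      case True
      then have "g1 (a (b x)) \<in> cycle_of t y" using cycle_of_commute[OF g1(2)] g1(4) by metis
      then show False using key w by simp
    next
      case False
      moreover have "a (b x) \<notin> cycle_of t y" using off y(2) by blast
      ultimately have "g1 (a (b x)) = a (b x)" using g1(6)[OF lt(6)] by blast
      then show False using key w by simp
    qed
  qed
  ultimately show ?thesis by blast
qed

text \<open>
  An element of the centralizer that does not commute with some conjugate moves a point to
  another cycle, and two elements with this property never have commuting conjugacy classes.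
\<close>
lemma not_split_centralizer_of_uniform_cycles:
  assumes n: "\<And>i. i \<ge> 1 \<Longrightarrow> n i > 1" and t: "t \<in> carrier (perm_limit n)"
  shows "\<not> split_centralizer (perm_limit n) t"
proof
  assume "split_centralizer (perm_limit n) t"
  then obtain a b c d where *: "a \<in> commutant (perm_limit n) t" "b \<in> commutant (perm_limit n) t"
      "conj_by_commutant (perm_limit n) t a c" "c \<circ> a \<noteq> a \<circ> c"
      "conj_by_commutant (perm_limit n) t b d" "d \<circ> b \<noteq> b \<circ> d"
      "\<And>c. conj_by_commutant (perm_limit n) t a c \<Longrightarrow> c \<circ> b = b \<circ> c"
    unfolding split_centralizer_def perm_limit_simps by blast
  have moves: "\<exists>x. f x \<notin> cycle_of t x"
    if f: "f \<in> commutant (perm_limit n) t" "conj_by_commutant (perm_limit n) t f c" "c \<circ> f \<noteq> f \<circ> c" for f c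
  proof (rule ccontr)
    assume "\<nexists>x. f x \<notin> cycle_of t x"
    moreover obtain g where "g \<in> carrier (perm_limit n)" "g \<circ> t = t \<circ> g" "c \<circ> t = t \<circ> c" "c \<circ> g = g \<circ> f"
      using f(2) by (auto simp: conj_by_commutant_def commutant_def)
    moreover have "f \<circ> t = t \<circ> f" using f(1) by (simp add: commutant_def)
    ultimately have "c \<circ> f = f \<circ> c"
      by (intro commute_of_cycle_preserving[of f c g]) (auto dest: bij_of_perm_limit)
    then show False using f(3) by simp
  qed
  obtain y0 x where m: "a y0 \<notin> cycle_of t y0" "b x \<notin> cycle_of t x"
    using moves[OF *(1,3,4)] moves[OF *(2,5,6)] by blast
  have "a \<in> carrier (perm_limit n)" "a \<circ> t = t \<circ> a" "b \<in> carrier (perm_limit n)" "b \<circ> t = t \<circ> b"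
    using *(1,2) by (simp_all add: commutant_def)
  then show False
    using noncommuting_conj[where n = n and a = a and b = b, OF n _ _ _ _ t m] *(7) by blast
qed

end


section \<open>The divisors of the stages\<close>

definition rotation :: "nat \<Rightarrow> nat \<Rightarrow> nat"
  where "rotation q = periodic_ext q (\<lambda>x. Suc x mod q)"

lemma funpow_rotation: "q > 0 \<Longrightarrow> (rotation q ^^ i) x = (x + i) mod q + q * (x div q)"
proof (induction i)
  case (Suc i)
  have "(rotation q ^^ Suc i) x = rotation q ((x + i) mod q + q * (x div q))" using Suc by simp
  also have "\<dots> = (x + Suc i) mod q + q * (x div q)"
    using Suc.prems by (simp add: rotation_def periodic_ext_def mod_Suc_eq)
  finally show ?case .
qed simp

lemma funpow_rotation_eq_iff:
  assumes "q > 0"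
  shows "(rotation q ^^ i) x = x \<longleftrightarrow> q dvd i"
proof -
  have "(rotation q ^^ i) x = x \<longleftrightarrow> (x + i) mod q + q * (x div q) = x mod q + q * (x div q)"
    unfolding funpow_rotation[OF assms] mod_mult_div_eq ..
  also have "\<dots> \<longleftrightarrow> (x + i) mod q = x mod q" by (rule add_right_cancel)
  also have "\<dots> \<longleftrightarrow> q dvd i" using mod_eq_dvd_iff_nat[of x "x + i" q] by simp
  finally show ?thesis .
qed

lemma rotation_block_perms:
  assumes q: "q > 0"
  shows "rotation q \<in> block_perms q"
  unfolding rotation_def
proof (rule periodic_ext_block_perms[OF q])
  have "inj_on (\<lambda>x. Suc x mod q) {..<q}"
  proof (rule inj_onI)
    fix x y assume "x \<in> {..<q}" "y \<in> {..<q}" "Suc x mod q = Suc y mod q"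
    then show "x = y" by (auto simp: mod_Suc split: if_splits)
  qed
  moreover have "(\<lambda>x. Suc x mod q) ` {..<q} \<subseteq> {..<q}" using q by auto
  ultimately show "bij_betw (\<lambda>x. Suc x mod q) {..<q} {..<q}"
    using endo_inj_surj[of "{..<q}" "\<lambda>x. Suc x mod q"] by (simp add: bij_betw_def)
qed

text \<open>
  If the centralizer of an element \<open>s\<close> of order \<open>q\<close> does not split,
  then no power of \<open>s\<close> that fixes a point moves another one. So a power fixing a
  point is the identity and its exponent is a multiple of \<open>q\<close>: all cycles of
  \<open>s\<close> have length \<open>q\<close>.
\<close>
lemma has_unsplit_element_iff:
  assumes n: "\<And>i. i \<ge> 1 \<Longrightarrow> n i > 1" and q: "q > 0"
  shows "has_unsplit_element (perm_limit n) q \<longleftrightarrow> (\<exists>k\<ge>1. q dvd NN n k)"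
proof
  assume "has_unsplit_element (perm_limit n) q"
  then obtain s where s: "s \<in> carrier (perm_limit n)" "\<And>i. s ^^ i = id \<longleftrightarrow> q dvd i"
      "\<not> split_centralizer (perm_limit n) s"
    by (auto simp: has_unsplit_element_def pow_perm_limit)
  have "(s ^^ i) x = x \<longleftrightarrow> q dvd i" for i x
  proof
    assume fixed: "(s ^^ i) x = x"
    show "q dvd i"
    proof (rule ccontr)
      assume "\<not> q dvd i"
      then obtain y where "(s ^^ i) y \<noteq> y" using s(2)[of i] by (auto simp: fun_eq_iff)
      then show False using split_centralizer_of_unequal_cycles[OF n s(1) fixed] s(3) by blast
    qed
  next
    assume "q dvd i"
    then have "s ^^ i = id" using s(2) by blast
    then show "(s ^^ i) x = x" by simp
  qed
  then have u: "uniform_cycles q s"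
    using q s(1) by (simp add: uniform_cycles_def bij_of_perm_limit)
  obtain k where "k \<ge> 1" "s \<in> block_perms (NN n k)" using s(1) by (auto simp: carrier_perm_limit)
  then show "\<exists>k\<ge>1. q dvd NN n k" using uniform_cycles_dvd[OF u] NN_pos[of n k, OF n] by blast
next
  assume "\<exists>k\<ge>1. q dvd NN n k"
  then obtain k where k: "k \<ge> 1" "q dvd NN n k" by blast
  let ?s = "rotation q"
  have s: "?s \<in> carrier (perm_limit n)"
    using perm_limit_stage[OF k(1)] block_perms_mono[OF k(2)] rotation_block_perms[OF q] by blast
  have u: "uniform_cycles q ?s"
    using q s by (simp add: uniform_cycles_def funpow_rotation_eq_iff bij_of_perm_limit)
  have "?s ^^ i = id \<longleftrightarrow> q dvd i" for i
    using funpow_rotation_eq_iff[OF q] by (auto simp: fun_eq_iff)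
  then show "has_unsplit_element (perm_limit n) q"
    using s not_split_centralizer_of_uniform_cycles[OF u n s]
    by (auto simp: has_unsplit_element_def pow_perm_limit)
qed

text \<open>
  If the divisors agree, each stage of one sequence divides a stage of the other, and the two
  groups of permutations of \<open>\<nat>\<close> are the same set.
\<close>
lemma isomorphic_iff_same_divisors:
  assumes n': "\<And>i. i \<ge> 1 \<Longrightarrow> n' i > 1" and n'': "\<And>i. i \<ge> 1 \<Longrightarrow> n'' i > 1"
  shows "lim_sym_group n' \<cong> lim_sym_group n'' \<longleftrightarrow>
    (\<forall>q>0. (\<exists>k\<ge>1. q dvd NN n' k) \<longleftrightarrow> (\<exists>k\<ge>1. q dvd NN n'' k))"
proof -
  have L': "perm_limit n' \<cong> lim_sym_group n'" using n' by (rule perm_limit_iso)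
  have L'': "perm_limit n'' \<cong> lim_sym_group n''" using n'' by (rule perm_limit_iso)
  note sym' = group.iso_sym[OF group_perm_limit L']
  note sym'' = group.iso_sym[OF group_perm_limit L'']
  show ?thesis
  proof
    assume "lim_sym_group n' \<cong> lim_sym_group n''"
    then have iso: "perm_limit n' \<cong> perm_limit n''" using iso_trans[OF iso_trans[OF L'] sym''] by blast
    have "has_unsplit_element (perm_limit n') q \<longleftrightarrow> has_unsplit_element (perm_limit n'') q" for q
      using has_unsplit_element_iso[OF group_perm_limit group_perm_limit]
        iso group.iso_sym[OF group_perm_limit iso] by blast
    then show "\<forall>q>0. (\<exists>k\<ge>1. q dvd NN n' k) \<longleftrightarrow> (\<exists>k\<ge>1. q dvd NN n'' k)"
      using has_unsplit_element_iff[of n', OF n'] has_unsplit_element_iff[of n'', OF n''] by blast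
  next
    assume same: "\<forall>q>0. (\<exists>k\<ge>1. q dvd NN n' k) \<longleftrightarrow> (\<exists>k\<ge>1. q dvd NN n'' k)"
    have sub: "carrier (perm_limit m) \<subseteq> carrier (perm_limit m')"
      if stage: "\<And>k. k \<ge> 1 \<Longrightarrow> \<exists>j\<ge>1. NN m k dvd NN m' j" for m m'
    proof
      fix f assume "f \<in> carrier (perm_limit m)"
      then obtain k where k: "k \<ge> 1" "f \<in> block_perms (NN m k)" by (auto simp: carrier_perm_limit)
      obtain j where j: "j \<ge> 1" "NN m k dvd NN m' j" using stage[OF k(1)] by blast
      then have "f \<in> block_perms (NN m' j)" using k(2) block_perms_mono by blast
      with j(1) show "f \<in> carrier (perm_limit m')" by (rule perm_limit_stage)
    qed
    have "NN n' k > 0" "NN n'' k > 0" for k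
      using NN_pos[of n', OF n'] NN_pos[of n'', OF n''] by blast+
    then have "carrier (perm_limit n') = carrier (perm_limit n'')"
      using same by (intro equalityI sub) (meson dvd_refl)+
    then have "perm_limit n' = perm_limit n''" by (simp add: perm_limit_def)
    then show "lim_sym_group n' \<cong> lim_sym_group n''" using iso_trans[OF sym'] L'' by simp
  qed
qed

lemma mono_multiplicity_NN:
  assumes n: "\<And>i. i \<ge> 1 \<Longrightarrow> n i > 1" and "k \<le> j"
  shows "multiplicity p (NN n k) \<le> multiplicity p (NN n j)"
  using NN_dvd[OF assms(2), of n] NN_pos[of n j, OF n] by (intro dvd_imp_multiplicity_le) auto

text \<open>
  For each of the finitely many primes dividing \<open>q\<close> some stage has a sufficient
  exponent, and exponents do not decrease, so a single stage serves for all these primes.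
\<close>
lemma dvd_stage_iff_multiplicity:
  assumes n: "\<And>i. i \<ge> 1 \<Longrightarrow> n i > 1" and q: "q > 0"
  shows "(\<exists>k\<ge>1. q dvd NN n k) \<longleftrightarrow>
    (\<forall>p. prime p \<longrightarrow> (\<exists>k. multiplicity p q \<le> multiplicity p (NN n k)))"
proof
  assume "\<exists>k\<ge>1. q dvd NN n k"
  then obtain k where "q dvd NN n k" by blast
  then have "multiplicity p q \<le> multiplicity p (NN n k)" for p
    using NN_pos[of n k, OF n] by (intro dvd_imp_multiplicity_le) auto
  then show "\<forall>p. prime p \<longrightarrow> (\<exists>k. multiplicity p q \<le> multiplicity p (NN n k))" by blast
next
  assume "\<forall>p. prime p \<longrightarrow> (\<exists>k. multiplicity p q \<le> multiplicity p (NN n k))"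
  then obtain K where K: "\<And>p. prime p \<Longrightarrow> multiplicity p q \<le> multiplicity p (NN n (K p))" by metis
  define k where "k = Max (insert 1 (K ` prime_factors q))"
  have le: "i \<le> k" if "i \<in> insert 1 (K ` prime_factors q)" for i
    unfolding k_def using that by (intro Max_ge) auto
  have "q dvd NN n k"
  proof (rule multiplicity_le_imp_dvd)
    fix p :: nat assume p: "prime p"
    show "multiplicity p q \<le> multiplicity p (NN n k)"
    proof (cases "p dvd q")
      case True
      then have "K p \<le> k" using p q by (intro le) (simp add: in_prime_factors_iff)
      then show ?thesis using K[OF p] mono_multiplicity_NN[of n "K p" k, OF n] le_trans by blast
    qed (simp add: not_dvd_imp_multiplicity_0)
  qed (use q in simp)
  then show "\<exists>k\<ge>1. q dvd NN n k" using le[of 1] by blast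
qed

lemma same_divisors_iff:
  assumes n': "\<And>i. i \<ge> 1 \<Longrightarrow> n' i > 1" and n'': "\<And>i. i \<ge> 1 \<Longrightarrow> n'' i > 1"
  shows "(\<forall>q>0. (\<exists>k\<ge>1. q dvd NN n' k) \<longleftrightarrow> (\<exists>k\<ge>1. q dvd NN n'' k)) \<longleftrightarrow>
    (\<forall>p. prime p \<longrightarrow> (\<forall>e. (\<exists>k. e \<le> multiplicity p (NN n' k)) \<longleftrightarrow> (\<exists>k. e \<le> multiplicity p (NN n'' k))))"
    (is "?L \<longleftrightarrow> ?R")
proof
  assume R: ?R
  show ?L
  proof (intro allI impI)
    fix q :: nat assume q: "q > 0"
    show "(\<exists>k\<ge>1. q dvd NN n' k) \<longleftrightarrow> (\<exists>k\<ge>1. q dvd NN n'' k)"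
    proof -
      have "(\<exists>k\<ge>1. q dvd NN n' k) \<longleftrightarrow>
          (\<forall>p. prime p \<longrightarrow> (\<exists>k. multiplicity p q \<le> multiplicity p (NN n' k)))"
        using n' q by (rule dvd_stage_iff_multiplicity)
      also have "\<dots> \<longleftrightarrow> (\<forall>p. prime p \<longrightarrow> (\<exists>k. multiplicity p q \<le> multiplicity p (NN n'' k)))"
        using R by blast
      also have "\<dots> \<longleftrightarrow> (\<exists>k\<ge>1. q dvd NN n'' k)"
        by (rule dvd_stage_iff_multiplicity[symmetric]) (use n'' q in blast)+
      finally show ?thesis .
    qed
  qed
next
  assume L: ?L
  show ?R
  proof (intro allI impI)
    fix p e :: nat assume p: "prime p"
    have *: "(\<exists>k\<ge>1. p ^ e dvd NN n k) \<longleftrightarrow> (\<exists>k. e \<le> multiplicity p (NN n k))"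
      if n: "\<And>i. i \<ge> 1 \<Longrightarrow> n i > 1" for n
    proof -
      have "p ^ e dvd NN n k \<longleftrightarrow> e \<le> multiplicity p (NN n k)" for k
        using NN_pos[of n k, OF n] p by (intro power_dvd_iff_le_multiplicity) (auto simp: prime_gt_1_nat)
      moreover have "\<exists>j\<ge>1. e \<le> multiplicity p (NN n j)" if "e \<le> multiplicity p (NN n k)" for k
        using that mono_multiplicity_NN[of n k "Suc k" p, OF n] by (intro exI[of _ "Suc k"]) auto
      ultimately show ?thesis by blast
    qed
    have "p ^ e > 0" using p by (simp add: prime_gt_0_nat)
    then show "(\<exists>k. e \<le> multiplicity p (NN n' k)) \<longleftrightarrow> (\<exists>k. e \<le> multiplicity p (NN n'' k))"
      using L *[of n', OF n'] *[of n'', OF n''] by blast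
  qed
qed


section \<open>Limits of increasing sequences of natural numbers\<close>

text \<open>
  In \<open>enat\<close> an increasing sequence converges to its supremum, and the supremum is
  determined by the natural numbers strictly below it.
\<close>
lemma common_enat_limit_iff:
  fixes f g :: "nat \<Rightarrow> nat"
  assumes "mono f" "mono g"
  shows "(\<exists>l. (\<lambda>k. enat (f k)) \<longlonglongrightarrow> l \<and> (\<lambda>k. enat (g k)) \<longlonglongrightarrow> l) \<longleftrightarrow>
    (\<forall>e. (\<exists>k. e \<le> f k) \<longleftrightarrow> (\<exists>k. e \<le> g k))" (is "?L \<longleftrightarrow> ?R")
proof -
  have lim: "(\<lambda>k. enat (h k)) \<longlonglongrightarrow> (SUP k. enat (h k))" if "mono h" for h :: "nat \<Rightarrow> nat"
    using that by (intro LIMSEQ_SUP) (auto simp: incseq_def mono_def)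
  have "?L \<longleftrightarrow> (SUP k. enat (f k)) = (SUP k. enat (g k))"
    using lim[OF assms(1)] lim[OF assms(2)] LIMSEQ_unique by metis
  also have "\<dots> \<longleftrightarrow> ?R"
  proof
    assume eq: "(SUP k. enat (f k)) = (SUP k. enat (g k))"
    have *: "(\<exists>k. Suc e \<le> h k) \<longleftrightarrow> enat e < (SUP k. enat (h k))" for e and h :: "nat \<Rightarrow> nat"
      by (simp add: less_SUP_iff Suc_le_eq)
    show ?R
    proof
      show "(\<exists>k. e \<le> f k) \<longleftrightarrow> (\<exists>k. e \<le> g k)" for e
        using *[of _ f] *[of _ g] eq by (cases e) auto
    qed
  next
    assume ?R
    then show "(SUP k. enat (f k)) = (SUP k. enat (g k))"
      by (intro antisym SUP_mono) (simp_all, blast+)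
  qed
  finally show ?thesis .
qed

lemma mono_bounded_eventually_const:
  fixes f :: "nat \<Rightarrow> nat"
  assumes "mono f" "\<And>k. f k \<le> B"
  obtains d where "eventually (\<lambda>k. f k = d) sequentially" "\<And>e. (\<exists>k. e \<le> f k) \<longleftrightarrow> e \<le> d"
proof -
  have fin: "finite (range f)" using assms(2) by (intro finite_subset[of "range f" "{..B}"]) auto
  then have "Max (range f) \<in> range f" by (intro Max_in) auto
  then obtain j where j: "f j = Max (range f)" by force
  have le: "f k \<le> f j" for k using Max_ge[OF fin, of "f k"] j by simp
  have "f k = f j" if "j \<le> k" for k using le[of k] monoD[OF assms(1) that] by simp
  then have "eventually (\<lambda>k. f k = f j) sequentially"
    unfolding eventually_sequentially by blast
  moreover have "(\<exists>k. e \<le> f k) \<longleftrightarrow> e \<le> f j" for e by (meson le le_trans)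
  ultimately show thesis using that by blast
qed

lemma unbounded_or_eventually_equal_iff:
  fixes f g :: "nat \<Rightarrow> nat"
  assumes "mono f" "mono g"
  shows "(\<not> bdd_above (f ` {1..}) \<and> \<not> bdd_above (g ` {1..})) \<or>
      (\<exists>d. eventually (\<lambda>k. f k = d \<and> g k = d) sequentially) \<longleftrightarrow>
    (\<forall>e. (\<exists>k. e \<le> f k) \<longleftrightarrow> (\<exists>k. e \<le> g k))" (is "?L \<longleftrightarrow> ?R")
proof -
  have bdd: "bdd_above (h ` {1..}) \<longleftrightarrow> (\<exists>B. \<forall>k. h k \<le> B)" if "mono h" for h :: "nat \<Rightarrow> nat"
  proof
    assume "bdd_above (h ` {1..})"
    then obtain B where B: "\<And>k. k \<ge> 1 \<Longrightarrow> h k \<le> B" by (auto simp: bdd_above_def)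
    have "h k \<le> B" for k using B[of "Suc k"] monoD[OF that, of k "Suc k"] by simp
    then show "\<exists>B. \<forall>k. h k \<le> B" by blast
  qed (auto simp: bdd_above_def)
  have all: "\<forall>e. \<exists>k. e \<le> h k" if "\<not> bdd_above (h ` {1..})" "mono h" for h :: "nat \<Rightarrow> nat"
    using that bdd[OF that(2)] by (meson nat_le_linear)
  show ?thesis
  proof
    assume ?L
    then show ?R
    proof
      assume "\<not> bdd_above (f ` {1..}) \<and> \<not> bdd_above (g ` {1..})"
      then show ?R using all[of f] all[of g] assms by simp
    next
      assume "\<exists>d. eventually (\<lambda>k. f k = d \<and> g k = d) sequentially"
      then obtain d j where j: "\<And>k. k \<ge> j \<Longrightarrow> f k = d \<and> g k = d" by (auto simp: eventually_sequentially)
      have le: "f k \<le> d" "g k \<le> d" for k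
        using monoD[OF assms(1), of k "max j k"] monoD[OF assms(2), of k "max j k"] j[of "max j k"] by auto
      have "(\<exists>k. e \<le> f k) \<longleftrightarrow> e \<le> d" "(\<exists>k. e \<le> g k) \<longleftrightarrow> e \<le> d" for e
        using j[OF order_refl] le by (metis le_trans)+
      then show ?R by simp
    qed
  next
    assume R: ?R
    show ?L
    proof (cases "bdd_above (f ` {1..}) \<or> bdd_above (g ` {1..})")
      case True
      then obtain B where "(\<forall>k. f k \<le> B) \<or> (\<forall>k. g k \<le> B)" using bdd[OF assms(1)] bdd[OF assms(2)] by metis
      moreover have "(\<forall>k. f k \<le> B) \<longleftrightarrow> (\<forall>k. g k \<le> B)"
        using R[rule_format, of "Suc B"] by (metis not_less_eq_eq)
      ultimately have B: "f k \<le> B" "g k \<le> B" for k by blast+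
      obtain d where d: "eventually (\<lambda>k. f k = d) sequentially" "\<And>e. (\<exists>k. e \<le> f k) \<longleftrightarrow> e \<le> d"
        using mono_bounded_eventually_const[OF assms(1) B(1)] by blast
      obtain d' where d': "eventually (\<lambda>k. g k = d') sequentially" "\<And>e. (\<exists>k. e \<le> g k) \<longleftrightarrow> e \<le> d'"
        using mono_bounded_eventually_const[OF assms(2) B(2)] by blast
      have "e \<le> d \<longleftrightarrow> e \<le> d'" for e using R d(2) d'(2) by simp
      then have "d = d'" by (metis order_antisym order_refl)
      then show ?thesis using eventually_conj[OF d(1) d'(1)] by blast
    qed simp
  qed
qed

section \<open>The classification\<close>

theorem theorem1p3:
  fixes n' n'' :: "nat \<Rightarrow> nat"
  assumes "\<And>k. k \<ge> 1 \<Longrightarrow> n' k > 1"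
    and "\<And>k. k \<ge> 1 \<Longrightarrow> n'' k > 1"
  shows "(lim_sym_group n' \<cong> lim_sym_group n'' \<longleftrightarrow>
      (\<forall>p::nat. prime p \<longrightarrow>
        (\<exists>l::enat. (\<lambda>k. enat (multiplicity p (NN n' k))) \<longlonglongrightarrow> l \<and>
                   (\<lambda>k. enat (multiplicity p (NN n'' k))) \<longlonglongrightarrow> l))) \<and>
    (lim_sym_group n' \<cong> lim_sym_group n'' \<longleftrightarrow>
      (\<forall>p::nat. prime p \<longrightarrow>
        (\<not> bdd_above ((\<lambda>k. multiplicity p (NN n' k)) ` {1..}) \<and>
         \<not> bdd_above ((\<lambda>k. multiplicity p (NN n'' k)) ` {1..})) \<or>
        (\<exists>d::nat. \<forall>\<^sub>F k in sequentially.
           multiplicity p (NN n' k) = d \<and> multiplicity p (NN n'' k) = d)))"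
proof -
  have mono: "mono (\<lambda>k. multiplicity p (NN n' k))" "mono (\<lambda>k. multiplicity p (NN n'' k))" for p
    using mono_multiplicity_NN[of n', OF assms(1)] mono_multiplicity_NN[of n'', OF assms(2)]
    by (auto intro!: monoI)
  have "lim_sym_group n' \<cong> lim_sym_group n'' \<longleftrightarrow> (\<forall>p. prime p \<longrightarrow>
      (\<forall>e. (\<exists>k. e \<le> multiplicity p (NN n' k)) \<longleftrightarrow> (\<exists>k. e \<le> multiplicity p (NN n'' k))))"
    using isomorphic_iff_same_divisors[of n' n'', OF assms] same_divisors_iff[of n' n'', OF assms]
    by simp
  then show ?thesis
    unfolding common_enat_limit_iff[OF mono] unbounded_or_eventually_equal_iff[OF mono] by blast
qed

end
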